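(* Let $\alpha<1$ and consider the game on $\mathbb{Z}^2$ in which Maker plays $m(t)=t^\alpha$ points on his $t$-th turn and Breaker plays $b(t)$ points on his $t$-th turn, with winning line segments of size $n$. If $b(t)=\omega(t^{1-\alpha})$ then the game is a Breaker win.
   Context: Let $m,b\colon\mathbb{N}\to\mathbb{N}$ be monotone increasing functions. Two players, Maker and Breaker, play in timesteps $t=1,2,\dots$; in timestep $t$ Maker first claims $m(t)$ previously unclaimed points of $\mathbb{Z}^2$, then Breaker claims $b(t)$ previously unclaimed points of $\mathbb{Z}^2$. A winning line segment is a set of $n$ points claimed by Maker lying on a common straight line (any direction) with no point claimed by Breaker on that line between the first and last of these $n$ points (other points of either player may lie on the line). Let $\tau_n$ be the earliest time by which Maker can guarantee (against every Breaker strategy) to have formed a winning line segment of $n$ points. The game is a Breaker win if $m(\tau_n)=(1-o(1))n$ as $n\to\infty$. The notation $f=\omega(g)$ means $f(n)/g(n)\to\infty$.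
   Formalization: The formal statement assumes 0<α<1: for α=0 Maker plays one point per turn, so m(τ_n)=(1-o(1))n is impossible, and for α<0 m is not increasing; t^α is rounded to its floor or ceiling. *)

theory Defs
  imports "HOL-Analysis.Analysis" "HOL-Library.Landau_Symbols"
begin

type_synonym point = "int \<times> int"

text \<open>A history lists the completed timesteps in chronological order, each as the pair of the set
  of points claimed by Maker and the set of points claimed by Breaker in reply. Timesteps are
  numbered from 1, so the timestep played after history \<open>h\<close> has number \<open>Suc (length h)\<close>.\<close>

type_synonym history = "(point set \<times> point set) list"

definition maker_points :: "history \<Rightarrow> point set" where
  "maker_points h = \<Union> (fst ` set h)"

definition breaker_points :: "history \<Rightarrow> point set" where
  "breaker_points h = \<Union> (snd ` set h)"

definition claimed :: "history \<Rightarrow> point set" where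
  "claimed h = maker_points h \<union> breaker_points h"

definition maker_strategy :: "(nat \<Rightarrow> nat) \<Rightarrow> (history \<Rightarrow> point set) \<Rightarrow> bool" where
  "maker_strategy m \<sigma> \<longleftrightarrow>
    (\<forall>h. finite (claimed h) \<longrightarrow>
      finite (\<sigma> h) \<and> card (\<sigma> h) = m (Suc (length h)) \<and> \<sigma> h \<inter> claimed h = {})"

text \<open>Breaker sees, besides the history, the set \<open>M\<close> just claimed by Maker.\<close>

definition breaker_strategy ::
  "(nat \<Rightarrow> nat) \<Rightarrow> (history \<Rightarrow> point set \<Rightarrow> point set) \<Rightarrow> bool" where
  "breaker_strategy b \<beta> \<longleftrightarrow>
    (\<forall>h M. finite (claimed h) \<longrightarrow> finite M \<longrightarrow>
      finite (\<beta> h M) \<and> card (\<beta> h M) = b (Suc (length h)) \<and> \<beta> h M \<inter> (claimed h \<union> M) = {})"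

fun play ::
  "(history \<Rightarrow> point set) \<Rightarrow> (history \<Rightarrow> point set \<Rightarrow> point set) \<Rightarrow> nat \<Rightarrow> history" where
  "play \<sigma> \<beta> 0 = []"
| "play \<sigma> \<beta> (Suc t) = (let h = play \<sigma> \<beta> t; M = \<sigma> h in h @ [(M, \<beta> h M)])"

definition to_plane :: "point \<Rightarrow> real \<times> real" where
  "to_plane p = (real_of_int (fst p), real_of_int (snd p))"

text \<open>\<open>M\<close> and \<open>B\<close> are the points of Maker and Breaker; \<open>x\<close> and \<open>y\<close> are the first and last of the
  \<open>n\<close> points of the segment \<open>S\<close>.\<close>

definition winning_segment :: "nat \<Rightarrow> point set \<Rightarrow> point set \<Rightarrow> point set \<Rightarrow> bool" where
  "winning_segment n M B S \<longleftrightarrow>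
    S \<subseteq> M \<and> finite S \<and> card S = n \<and> collinear (to_plane ` S) \<and>
    (\<exists>x\<in>S. \<exists>y\<in>S.
      (\<forall>p\<in>S. between (to_plane x, to_plane y) (to_plane p)) \<and>
      (\<forall>p\<in>B. \<not> between (to_plane x, to_plane y) (to_plane p)))"

text \<open>The position is inspected right after Maker's move in timestep \<open>Suc s \<le> t\<close>, when Breaker has
  only made his moves of the first \<open>s\<close> timesteps.\<close>

definition maker_guarantees :: "(nat \<Rightarrow> nat) \<Rightarrow> (nat \<Rightarrow> nat) \<Rightarrow> nat \<Rightarrow> nat \<Rightarrow> bool" where
  "maker_guarantees m b n t \<longleftrightarrow>
    (\<exists>\<sigma>. maker_strategy m \<sigma> \<and>
      (\<forall>\<beta>. breaker_strategy b \<beta> \<longrightarrow>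
        (\<exists>s<t. \<exists>S. winning_segment n
          (maker_points (play \<sigma> \<beta> (Suc s))) (breaker_points (play \<sigma> \<beta> s)) S)))"

definition winning_time :: "(nat \<Rightarrow> nat) \<Rightarrow> (nat \<Rightarrow> nat) \<Rightarrow> nat \<Rightarrow> nat" where
  "winning_time m b n = (LEAST t. maker_guarantees m b n t)"

text \<open>The first conjunct says that \<open>winning_time\<close> is a genuine minimum for large \<open>n\<close>; \<open>LEAST\<close> would
  otherwise be unspecified. The second one is \<open>m (\<tau>\<^sub>n) = (1 - o(1)) n\<close>.\<close>

definition breaker_win :: "(nat \<Rightarrow> nat) \<Rightarrow> (nat \<Rightarrow> nat) \<Rightarrow> bool" where
  "breaker_win m b \<longleftrightarrow>
    (\<forall>\<^sub>F n in sequentially. \<exists>t. maker_guarantees m b n t) \<and>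
    (\<exists>\<epsilon> :: nat \<Rightarrow> real. \<epsilon> \<in> o(\<lambda>_. 1) \<and>
      (\<forall>\<^sub>F n in sequentially. real (m (winning_time m b n)) = (1 - \<epsilon> n) * real n))"

end

theory Submission
  imports Defs
begin

text \<open>Maker gets \<open>n\<close> points in a row at once as soon as \<open>m t \<ge> n\<close>, so only the lower bound on the winning
  time is at issue. To win at a time with \<open>m t < (1 - \<epsilon>) n\<close>, Maker must complete a segment that already
  holds \<open>\<epsilon> n\<close> of his points. By the Szemeredi-Trotter theorem, \<open>N\<close> points span only
  \<open>O(N\<^sup>2 / k\<^sup>3 + N / k)\<close> disjoint segments with \<open>k\<close> points each. For \<open>N \<approx> t\<^sup>1\<^sup>+\<^sup>\<alpha>\<close>, the number of points that Maker
  claims up to time \<open>t\<close>, and \<open>k \<approx> t\<^sup>\<alpha>\<close>, this is \<open>O(t\<^sup>2\<^sup>-\<^sup>\<alpha>)\<close>, which Breaker can afford when he claims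
  \<open>\<omega>(t\<^sup>1\<^sup>-\<^sup>\<alpha>)\<close> points per timestep.

  As Maker may create many such segments in a short time, Breaker applies this bound to the sets of
  points that Maker claims in each dyadic window of time. The segments of a window of length \<open>2 ^ i\<close>
  with at least \<open>k i\<close> points are blocked during the next window of that length. The past is covered by
  two blocked windows per level, so no segment that can still be extended holds more than
  \<open>\<Sum>i. 2 * k i\<close> old points of Maker.\<close>

section \<open>Plane graphs and the crossing inequality\<close>

text \<open>Breaker cannot know which interval of a rich line Maker will extend, nor where. Blocking
  is therefore organised around pivots: on every rich line, a sparse set of points that meets each
  interval with \<open>k\<close> points of the window. From a pivot Breaker claims the nearest free
  lattice point in either direction of the line; a point of the line that is still free afterwards
  lies beyond such a reply. A line with \<open>r\<close> points needs at most \<open>r / k\<close>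
  pivots, so what has to be bounded is the number of incidences on rich lines, not only the number
  of these lines.

  The latest windows of a level are not blocked yet, but finer levels take care of them. Only
  Maker's current move is left over, and it contributes at most \<open>m T\<close> points.

  The incidence bound rests on the crossing inequality for straight-line graphs. Edges are treated
  as functions of the abscissa, which keeps topology out: a crossing is a change of vertical order,
  and the linear bound on the edges of a plane graph comes from charging edges to vertices instead
  of Euler's formula. Distinct abscissae are obtained by a shear of the lattice.\<close>

definition slope :: "('v \<Rightarrow> real) \<Rightarrow> ('v \<Rightarrow> real) \<Rightarrow> 'v \<times> 'v \<Rightarrow> real" where
  "slope X Y e = (Y (snd e) - Y (fst e)) / (X (snd e) - X (fst e))"

definition height :: "('v \<Rightarrow> real) \<Rightarrow> ('v \<Rightarrow> real) \<Rightarrow> 'v \<times> 'v \<Rightarrow> real \<Rightarrow> real" where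
  "height X Y e x = Y (fst e) + (x - X (fst e)) * slope X Y e"

definition spans :: "('v \<Rightarrow> real) \<Rightarrow> 'v \<times> 'v \<Rightarrow> real \<Rightarrow> bool" where
  "spans X e x \<longleftrightarrow> X (fst e) \<le> x \<and> x \<le> X (snd e)"

text \<open>Two affine functions cross when their strict order differs at two common abscissae. No
  point of intersection has to be named, and edges that merely touch or overlap do not
  cross.\<close>

definition crossing :: "('v \<Rightarrow> real) \<Rightarrow> ('v \<Rightarrow> real) \<Rightarrow> 'v \<times> 'v \<Rightarrow> 'v \<times> 'v \<Rightarrow> bool" where
  "crossing X Y e f \<longleftrightarrow> (\<exists>x z. spans X e x \<and> spans X f x \<and> spans X e z \<and> spans X f z \<and>
     height X Y e x < height X Y f x \<and> height X Y f z < height X Y e z)"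

text \<open>Directing edges by increasing abscissa lets ordered pairs represent undirected edges.
  The last assumption excludes overlapping edges, since an end of one would lie inside the
  other.\<close>

locale geometric_graph =
  fixes X Y :: "'v \<Rightarrow> real" and V :: "'v set" and E :: "('v \<times> 'v) set"
  assumes finite_vertices: "finite V"
    and inj_abscissa: "inj_on X V"
    and edge: "e \<in> E \<Longrightarrow> fst e \<in> V \<and> snd e \<in> V \<and> X (fst e) < X (snd e)"
    and vertex_off_edge: "e \<in> E \<Longrightarrow> v \<in> V \<Longrightarrow> X (fst e) < X v \<Longrightarrow> X v < X (snd e)
      \<Longrightarrow> height X Y e (X v) \<noteq> Y v"
begin

abbreviation "sl \<equiv> slope X Y"
abbreviation "ht \<equiv> height X Y"

lemma finite_edges: "finite E"
  by (rule finite_subset[of _ "V \<times> V"]) (use edge finite_vertices in \<open>auto simp: mem_Times_iff\<close>)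

lemma height_fst: "ht e (X (fst e)) = Y (fst e)"
  by (simp add: height_def)

lemma height_snd: "e \<in> E \<Longrightarrow> ht e (X (snd e)) = Y (snd e)"
  using edge[of e] by (simp add: height_def slope_def)

text \<open>Otherwise the shorter edge would end in the interior of the longer one.\<close>

lemma edge_eqI:
  assumes "e \<in> E" "f \<in> E" "fst e = fst f" "sl e = sl f"
  shows "e = f"
proof -
  have ht: "ht e = ht f" using assms by (simp add: height_def fun_eq_iff)
  have "X (snd e) = X (snd f)"
  proof (rule ccontr)
    assume "X (snd e) \<noteq> X (snd f)"
    then consider "X (snd e) < X (snd f)" | "X (snd f) < X (snd e)" by linarith
    then show False
      using vertex_off_edge[of e "snd f"] vertex_off_edge[of f "snd e"] edge[of e] edge[of f]
        height_snd[of e] height_snd[of f] assms ht by cases auto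
  qed
  then have "snd e = snd f" using inj_abscissa edge[of e] edge[of f] assms by (auto simp: inj_on_def)
  with assms show ?thesis by (simp add: prod_eq_iff)
qed

lemma height_less_iff:
  assumes "fst e = fst f" "X (fst e) < x"
  shows "ht e x < ht f x \<longleftrightarrow> sl e < sl f"
  using assms by (simp add: height_def)

lemma height_le_iff:
  assumes "fst e = fst f" "X (fst e) < x"
  shows "ht e x \<le> ht f x \<longleftrightarrow> sl e \<le> sl f"
  using assms by (simp add: height_def)

text \<open>If the left ends differed, the later one would be a vertex in the interior of the other
  edge.\<close>

lemma edge_eqI_snd:
  assumes "e \<in> E" "f \<in> E" "snd e = snd f" "x = max (X (fst e)) (X (fst f))" "ht e x = ht f x"
  shows "e = f"
proof -
  have "X (fst e) = X (fst f)"
  proof (rule ccontr)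
    assume "X (fst e) \<noteq> X (fst f)"
    then consider "X (fst e) < X (fst f)" | "X (fst f) < X (fst e)" by linarith
    then show False
      using vertex_off_edge[of e "fst f"] vertex_off_edge[of f "fst e"] edge[of e] edge[of f]
        height_fst[of e] height_fst[of f] assms by cases (auto simp: max_def)
  qed
  then have "fst e = fst f" using inj_abscissa edge[of e] edge[of f] assms by (auto simp: inj_on_def)
  with assms show ?thesis by (simp add: prod_eq_iff)
qed

end

locale plane_graph = geometric_graph +
  assumes no_crossing: "e \<in> E \<Longrightarrow> f \<in> E \<Longrightarrow> \<not> crossing X Y e f"
begin

lemma height_mono:
  assumes "e \<in> E" "f \<in> E" "spans X e x" "spans X f x" "spans X e z" "spans X f z" "ht e x < ht f x"
  shows "ht e z \<le> ht f z"
  using no_crossing[of e f] assms unfolding crossing_def by force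

text \<open>An edge that is not the steepest one leaving its left endpoint spans a wedge with the next
  steeper edge. It is charged to the leftmost vertex of that wedge; every vertex is charged at most
  once as the right end of the lower edge, once as the right end of the upper edge and once as an
  inner point of the wedge.\<close>

lemma card_edges_le: "card E \<le> 4 * card V"
proof -
  define Top where "Top = {e \<in> E. \<forall>f\<in>E. fst f = fst e \<longrightarrow> sl f \<le> sl e}"
  have "\<exists>f\<in>E. fst f = fst e \<and> sl e < sl f \<and> (\<forall>g\<in>E. fst g = fst e \<longrightarrow> sl e < sl g \<longrightarrow> sl f \<le> sl g)"
    if "e \<in> E - Top" for e
  proof -
    define F where "F = {f \<in> E. fst f = fst e \<and> sl e < sl f}"
    have "finite F" "F \<noteq> {}" using that finite_edges by (auto simp: F_def Top_def not_le)
    then obtain f where "f \<in> F" "\<forall>g\<in>F. sl f \<le> sl g"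
      by (metis (no_types, lifting) arg_min_if_finite(1) arg_min_least)
    then show ?thesis by (auto simp: F_def)
  qed
  then obtain up where up: "\<And>e. e \<in> E - Top \<Longrightarrow> up e \<in> E \<and> fst (up e) = fst e \<and> sl e < sl (up e) \<and>
      (\<forall>g\<in>E. fst g = fst e \<longrightarrow> sl e < sl g \<longrightarrow> sl (up e) \<le> sl g)"
    by metis
  \<comment> \<open>The vertices in the wedge between \<open>e\<close> and the next steeper edge,
    cut off where the shorter of the two ends. The common left end is excluded.\<close>
  define W where "W e = {v \<in> V. X (fst e) < X v \<and> X v \<le> X (snd e) \<and> X v \<le> X (snd (up e)) \<and>
      ht e (X v) \<le> Y v \<and> Y v \<le> ht (up e) (X v)}" for e
  have "\<exists>v\<in>W e. \<forall>w\<in>W e. X v \<le> X w" if e: "e \<in> E - Top" for e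
  proof -
    note u = up[OF e]
    \<comment> \<open>The wedge contains a vertex because the shorter of its two sides ends
      there.\<close>
    have "snd e \<in> W e \<or> snd (up e) \<in> W e"
    proof (cases "X (snd e) \<le> X (snd (up e))")
      case True
      have "ht e (X (snd e)) \<le> ht (up e) (X (snd e))"
        using height_le_iff[of e "up e" "X (snd e)"] u edge[of e] e by auto
      then have "snd e \<in> W e" using True edge[of e] e height_snd[of e] by (auto simp: W_def)
      then show ?thesis ..
    next
      case False
      have "ht e (X (snd (up e))) \<le> ht (up e) (X (snd (up e)))"
        using height_le_iff[of e "up e" "X (snd (up e))"] u edge[of "up e"] by auto
      then have "snd (up e) \<in> W e" using False edge[of "up e"] u height_snd[of "up e"]
        by (auto simp: W_def)
      then show ?thesis ..
    qed
    moreover have "finite (W e)" using finite_vertices by (simp add: W_def)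
    ultimately show ?thesis
      by (metis (no_types, lifting) arg_min_if_finite(1) arg_min_least empty_iff)
  qed
  then obtain apex where apex: "\<And>e. e \<in> E - Top \<Longrightarrow> apex e \<in> W e \<and> (\<forall>w\<in>W e. X (apex e) \<le> X w)"
    by metis
  have apexW: "apex e \<in> V" "X (fst e) < X (apex e)" "X (apex e) \<le> X (snd e)"
      "X (apex e) \<le> X (snd (up e))" "ht e (X (apex e)) \<le> Y (apex e)"
      "Y (apex e) \<le> ht (up e) (X (apex e))" if "e \<in> E - Top" for e
    using apex[OF that] by (auto simp: W_def)
  have outside: False if "e \<in> E - Top" "v \<in> V" "X (fst e) < X v" "X v < X (apex e)"
    "ht e (X v) \<le> Y v" "Y v \<le> ht (up e) (X v)" for e v
    using apex[OF that(1)] apexW[OF that(1)] that by (force simp: W_def)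
  have apex_V: "apex ` F \<subseteq> V" if "F \<subseteq> E - Top" for F
    using that apexW(1) by blast
  define E1 where "E1 = {e \<in> E - Top. apex e = snd e}"
  define E2 where "E2 = {e \<in> E - Top. apex e = snd (up e)}"
  define E3 where "E3 = {e \<in> E - Top. apex e \<noteq> snd e \<and> apex e \<noteq> snd (up e)}"
  \<comment> \<open>Each of the four classes will be mapped injectively to the vertices, hence the
    factor 4.\<close>
  have E: "E \<subseteq> Top \<union> E1 \<union> E2 \<union> E3" by (auto simp: E1_def E2_def E3_def)
  have "inj_on fst Top"
    by (intro inj_onI edge_eqI) (auto simp: Top_def intro!: antisym)
  then have cT: "card Top \<le> card V"
    by (rule card_inj_on_le) (use edge finite_vertices in \<open>auto simp: Top_def\<close>)
  \<comment> \<open>Just left of the common end, the upper edge \<open>f\<close> is squeezed between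
    \<open>e\<close> and \<open>up e\<close>, and without crossings it stays there. Hence
    \<open>f\<close> starts inside the wedge of \<open>e\<close>, to the left of its apex.\<close>
  have "False" if ef: "e \<in> E1" "f \<in> E1" "snd e = snd f" and x: "x = max (X (fst e)) (X (fst f))"
    "ht e x < ht f x" for e f x
  proof -
    let ?b = "snd e"
    have e: "e \<in> E - Top" "f \<in> E - Top" "apex e = ?b" "apex f = ?b" using ef by (auto simp: E1_def)
    note u = up[OF e(1)]
    have lt: "X (fst e) < X ?b" "X (fst f) < X ?b" using e edge[of e] edge[of f] ef by auto
    have ub: "X ?b \<le> X (snd (up e))" using apexW(4)[OF e(1)] e by simp
    have "ht e (X ?b) < ht (up e) (X ?b)"
      using height_less_iff[of e "up e"] u lt by simp
    then have "ht f (X ?b) < ht (up e) (X ?b)" using height_snd[of e] height_snd[of f] e ef by simp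
    then have "ht f x \<le> ht (up e) x"
      by (rule height_mono[rotated -1]) (use e u lt ub x ef in \<open>auto simp: spans_def\<close>)
    then have "x \<noteq> X (fst e)" using x u height_fst[of e] height_fst[of "up e"] by auto
    then have xf: "x = X (fst f)" "X (fst e) < x" using x by (auto simp: max_def split: if_splits)
    show False
      using outside[of e "fst f"] e(1,3) edge[of f] e(2) xf lt x(2) \<open>ht f x \<le> ht (up e) x\<close>
        height_fst[of f] by auto
  qed
  note E1 = this
  have "inj_on apex E1"
  proof (rule inj_onI)
    fix e f assume ef: "e \<in> E1" "f \<in> E1" "apex e = apex f"
    then have e: "e \<in> E" "f \<in> E" "snd e = snd f" by (auto simp: E1_def)
    let ?x = "max (X (fst e)) (X (fst f))"
    have "ht e ?x = ht f ?x"
      using E1[OF ef(1,2) e(3) refl] E1[OF ef(2,1) e(3)[symmetric] refl]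
      by (metis linorder_less_linear max.commute)
    then show "e = f" using edge_eqI_snd[of e f] e by auto
  qed
  then have c1: "card E1 \<le> card V"
    by (rule card_inj_on_le[OF _ apex_V finite_vertices]) (auto simp: E1_def)
  \<comment> \<open>The same argument upside down: now \<open>up f\<close> is squeezed between
    \<open>e\<close> and \<open>up e\<close>.\<close>
  have "False" if ef: "e \<in> E2" "f \<in> E2" "snd (up e) = snd (up f)"
    and x: "x = max (X (fst e)) (X (fst f))" "ht (up f) x < ht (up e) x" for e f x
  proof -
    let ?c = "snd (up e)"
    have e: "e \<in> E - Top" "f \<in> E - Top" "apex e = ?c" "apex f = ?c" using ef by (auto simp: E2_def)
    note u = up[OF e(1)] and u' = up[OF e(2)]
    have lt: "X (fst e) < X ?c" "X (fst f) < X ?c"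
      using u u' edge[of "up e"] edge[of "up f"] ef by auto
    have ub: "X ?c \<le> X (snd e)" using apexW(3)[OF e(1)] e by simp
    have "ht e (X ?c) < ht (up e) (X ?c)"
      using height_less_iff[of e "up e"] u lt by simp
    then have "ht e (X ?c) < ht (up f) (X ?c)"
      using height_snd[of "up e"] height_snd[of "up f"] u u' ef by simp
    then have le: "ht e x \<le> ht (up f) x"
      by (rule height_mono[rotated -1]) (use e u u' lt ub x ef in \<open>auto simp: spans_def\<close>)
    then have "x \<noteq> X (fst e)" using x u height_fst[of e] height_fst[of "up e"] by auto
    then have xf: "x = X (fst f)" "X (fst e) < x" using x by (auto simp: max_def split: if_splits)
    show False
      using outside[of e "fst f"] e(1,3) edge[of f] e(2) xf lt x(2) le u'
        height_fst[of "up f"] by auto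
  qed
  note E2 = this
  have "inj_on apex E2"
  proof (rule inj_onI)
    fix e f assume ef: "e \<in> E2" "f \<in> E2" "apex e = apex f"
    then have e: "e \<in> E - Top" "f \<in> E - Top" "snd (up e) = snd (up f)" by (auto simp: E2_def)
    note u = up[OF e(1)] and u' = up[OF e(2)]
    let ?x = "max (X (fst e)) (X (fst f))"
    have "ht (up e) ?x = ht (up f) ?x"
      using E2[OF ef(1,2) e(3) refl] E2[OF ef(2,1) e(3)[symmetric] refl]
      by (metis linorder_less_linear max.commute)
    then have upe: "up e = up f" using edge_eqI_snd[of "up e" "up f"] u u' e by auto
    then have "sl e = sl f" using u u' e by (metis DiffD1 leD linorder_less_linear)
    then show "e = f" using edge_eqI[of e f] u u' upe e by auto
  qed
  then have c2: "card E2 \<le> card V"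
    by (rule card_inj_on_le[OF _ apex_V finite_vertices]) (auto simp: E2_def)
  have strict: "X (apex e) < X (snd e)" "X (apex e) < X (snd (up e))"
     "ht e (X (apex e)) < Y (apex e)" "Y (apex e) < ht (up e) (X (apex e))" if "e \<in> E3" for e
  proof -
    have e: "e \<in> E - Top" "apex e \<noteq> snd e" "apex e \<noteq> snd (up e)" using that by (auto simp: E3_def)
    note u = up[OF e(1)] and a = apexW[OF e(1)]
    show 1: "X (apex e) < X (snd e)" "X (apex e) < X (snd (up e))"
      using a e u edge[of e] edge[of "up e"] inj_abscissa unfolding inj_on_def
      by (metis DiffD1 order_le_less)+
    show "ht e (X (apex e)) < Y (apex e)" "Y (apex e) < ht (up e) (X (apex e))"
      using vertex_off_edge[of e "apex e"] vertex_off_edge[of "up e" "apex e"] a u e 1 by auto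
  qed
  have same: "\<not> sl e < sl f" if "e \<in> E3" "f \<in> E3" "fst e = fst f" "apex e = apex f" for e f
  proof
    assume "sl e < sl f"
    then have "sl (up e) \<le> sl f" using that up[of e] by (auto simp: E3_def)
    then have "ht (up e) (X (apex e)) \<le> ht f (X (apex e))"
      using height_le_iff[of "up e" f "X (apex e)"] that up[of e] apexW(2)[of e] by (auto simp: E3_def)
    then show False using strict[OF that(1)] strict[OF that(2)] that by auto
  qed
  have diff: "\<not> X (fst e) < X (fst f)" if ef: "e \<in> E3" "f \<in> E3" "apex e = apex f" for e f
  proof
    assume lt: "X (fst e) < X (fst f)"
    have e: "e \<in> E - Top" "f \<in> E - Top" using ef by (auto simp: E3_def)
    note u = up[OF e(1)] and u' = up[OF e(2)] and s = strict[OF ef(1)] and s' = strict[OF ef(2)]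
    let ?a = "fst f"
    have av: "X ?a < X (apex e)" using apexW(2)[OF e(2)] ef by simp
    \<comment> \<open>The left end of \<open>f\<close> precedes the apex and so lies outside the
      wedge of \<open>e\<close>, say below it. Then \<open>up f\<close> stays below \<open>e\<close>
      as far as the apex, which cannot be strictly inside both wedges.\<close>
    have "\<not> (ht e (X ?a) \<le> Y ?a \<and> Y ?a \<le> ht (up e) (X ?a))"
      using outside[of e ?a] e lt av edge[of f] by auto
    then consider "ht (up f) (X ?a) < ht e (X ?a)" | "ht (up e) (X ?a) < ht f (X ?a)"
      using height_fst[of f] height_fst[of "up f"] u' by force
    then show False
    proof cases
      case 1
      then have "ht (up f) (X (apex e)) \<le> ht e (X (apex e))"
        by (rule height_mono[rotated -1]) (use e u u' lt av s s' ef in \<open>auto simp: spans_def\<close>)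
      then show False using s s' ef by auto
    next
      case 2
      then have "ht (up e) (X (apex e)) \<le> ht f (X (apex e))"
        by (rule height_mono[rotated -1]) (use e u u' lt av s s' ef in \<open>auto simp: spans_def\<close>)
      then show False using s s' ef by auto
    qed
  qed
  have "inj_on apex E3"
  proof (rule inj_onI)
    fix e f assume ef: "e \<in> E3" "f \<in> E3" "apex e = apex f"
    then have e: "e \<in> E" "f \<in> E" by (auto simp: E3_def)
    have "X (fst e) = X (fst f)" using diff[of e f] diff[of f e] ef by force
    then have "fst e = fst f" using inj_abscissa edge[of e] edge[of f] e by (auto simp: inj_on_def)
    moreover from this have "sl e = sl f" using same[of e f] same[of f e] ef by force
    ultimately show "e = f" using edge_eqI e by blast
  qed
  then have c3: "card E3 \<le> card V"
    by (rule card_inj_on_le[OF _ apex_V finite_vertices]) (auto simp: E3_def)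
  have "finite (Top \<union> E1 \<union> E2 \<union> E3)" using finite_edges by (auto simp: Top_def E1_def E2_def E3_def)
  then have "card E \<le> card (Top \<union> E1 \<union> E2 \<union> E3)" using E by (rule card_mono)
  also have "\<dots> \<le> card Top + card E1 + card E2 + card E3"
    by (meson card_Un_le add_mono order_refl order_trans)
  finally show ?thesis using cT c1 c2 c3 by simp
qed

end

section \<open>Counting crossings and sampling vertices\<close>

context geometric_graph
begin

lemma subgraph:
  assumes "V' \<subseteq> V" "E' \<subseteq> E" "\<And>e. e \<in> E' \<Longrightarrow> fst e \<in> V' \<and> snd e \<in> V'"
  shows "geometric_graph X Y V' E'"
proof
  show "finite V'" using assms(1) finite_vertices finite_subset by blast
  show "inj_on X V'" using assms(1) inj_abscissa inj_on_subset by blast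
next
  fix e assume "e \<in> E'"
  then show "fst e \<in> V' \<and> snd e \<in> V' \<and> X (fst e) < X (snd e)"
    using assms edge[of e] by blast
next
  fix e v assume "e \<in> E'" "v \<in> V'" "X (fst e) < X v" "X v < X (snd e)"
  then show "ht e (X v) \<noteq> Y v" using assms vertex_off_edge[of e v] by blast
qed

text \<open>Ordered pairs, so each geometric crossing counts twice; this fits the later bound by the
  square of the number of lines.\<close>

definition crossings :: "(('v \<times> 'v) \<times> 'v \<times> 'v) set" where
  "crossings = {(e, f) \<in> E \<times> E. crossing X Y e f}"

lemma finite_crossings: "finite crossings"
  by (rule finite_subset[of _ "E \<times> E"]) (auto simp: crossings_def finite_edges)

text \<open>Deleting the first edge of every crossing pair leaves a plane graph.\<close>

lemma card_edges_le_crossings: "card E \<le> 4 * card V + card crossings"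
proof -
  let ?E = "E - fst ` crossings"
  interpret G: geometric_graph X Y V ?E
    by (rule subgraph) (use edge in auto)
  interpret G: plane_graph X Y V ?E
    by unfold_locales (force simp: crossings_def)
  have "card E \<le> card (?E \<union> fst ` crossings)"
    by (rule card_mono) (use finite_edges finite_crossings in auto)
  also have "\<dots> \<le> card ?E + card (fst ` crossings)" by (rule card_Un_le)
  also have "\<dots> \<le> 4 * card V + card crossings"
    using G.card_edges_le card_image_le[OF finite_crossings, of fst] by linarith
  finally show ?thesis .
qed

text \<open>Edges with a common left or right end keep their order, and edges that meet end to start
  share only one abscissa. A crossing thus survives the sampling of vertices with probability
  exactly \<open>1 / q ^ 4\<close>.\<close>

lemma crossing_distinct:
  assumes "e \<in> E" "f \<in> E" "crossing X Y e f"
  shows "card {fst e, snd e, fst f, snd f} = 4"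
proof -
  obtain x z where x: "X (fst e) \<le> x" "x \<le> X (snd e)" "X (fst f) \<le> x" "x \<le> X (snd f)"
      "ht e x < ht f x"
    and z: "X (fst e) \<le> z" "z \<le> X (snd e)" "X (fst f) \<le> z" "z \<le> X (snd f)" "ht f z < ht e z"
    using assms(3) by (auto simp: crossing_def spans_def)
  note ef = edge[OF assms(1)] edge[OF assms(2)]
  have 1: "fst e \<noteq> fst f"
  proof
    assume eq: "fst e = fst f"
    have "(x - X (fst e)) * sl e < (x - X (fst e)) * sl f" using x(5) eq by (simp add: height_def)
    moreover have "(z - X (fst e)) * sl f < (z - X (fst e)) * sl e"
      using z(5) eq by (simp add: height_def)
    ultimately show False using x z by (auto simp: mult_less_cancel_left)
  qed
  have 2: "snd e \<noteq> snd f"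
  proof
    assume eq: "snd e = snd f"
    have h: "ht g y = Y (snd g) - (X (snd g) - y) * sl g" if "g \<in> E" for g y
      using height_snd[OF that] by (simp add: height_def algebra_simps)
    have "(X (snd e) - x) * sl f < (X (snd e) - x) * sl e"
      using x(5) eq h assms by simp
    moreover have "(X (snd e) - z) * sl e < (X (snd e) - z) * sl f"
      using z(5) eq h assms by simp
    ultimately show False using x z by (auto simp: mult_less_cancel_left)
  qed
  have 3: "fst e \<noteq> snd f"
  proof
    assume "fst e = snd f"
    then have "x = z" using x z by simp
    then show False using x z by simp
  qed
  have 4: "snd e \<noteq> fst f"
  proof
    assume "snd e = fst f"
    then have "x = z" using x z by simp
    then show False using x z by simp
  qed
  show ?thesis using 1 2 3 4 ef by (auto simp: card_insert_if)
qed

end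

text \<open>The vertices of colour 0 in a uniform colouring with \<open>q\<close> colours form the
  random vertex set of density \<open>1 / q\<close>. Counting colourings keeps the averaging within
  the natural numbers.\<close>

lemma card_colourings_fixing:
  assumes "finite V" "U \<subseteq> V" "0 < q"
  shows "card {f \<in> V \<rightarrow>\<^sub>E {..<q}. \<forall>u\<in>U. f u = 0} * q ^ card U = q ^ card V"
proof -
  have "{f \<in> V \<rightarrow>\<^sub>E {..<q}. \<forall>u\<in>U. f u = 0} = Pi\<^sub>E V (\<lambda>v. if v \<in> U then {0} else {..<q})"
    using assms by (auto simp: PiE_iff extensional_def split: if_splits)
  moreover have "(\<Prod>v\<in>V. card (if v \<in> U then {0} else {..<q})) = (\<Prod>v\<in>V - U. q)"
    by (rule prod.mono_neutral_cong_right) (use assms in auto)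
  ultimately have "card {f \<in> V \<rightarrow>\<^sub>E {..<q}. \<forall>u\<in>U. f u = 0} = q ^ card (V - U)"
    using assms by (simp add: card_PiE)
  moreover have "card V = card (V - U) + card U"
    using assms by (metis card_Diff_subset card_mono finite_subset le_add_diff_inverse2)
  ultimately show ?thesis by (simp add: power_add)
qed

text \<open>Linearity of expectation, as a double count: \<open>x\<close> survives when all
  \<open>r\<close> vertices of \<open>U x\<close> are sampled.\<close>

lemma sum_card_colourings:
  assumes "finite V" "finite A" "0 < q" "\<And>x. x \<in> A \<Longrightarrow> U x \<subseteq> V \<and> card (U x) = r"
  shows "(\<Sum>f\<in>V \<rightarrow>\<^sub>E {..<q}. card {x \<in> A. \<forall>u\<in>U x. f u = 0}) * q ^ r = card A * q ^ card V"
proof -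
  let ?F = "V \<rightarrow>\<^sub>E {..<q}"
  have fin: "finite ?F" using assms by (simp add: finite_PiE)
  have "(\<Sum>f\<in>?F. card {x \<in> A. \<forall>u\<in>U x. f u = 0}) = (\<Sum>x\<in>A. card {f \<in> ?F. \<forall>u\<in>U x. f u = 0})"
    using sum.swap_restrict[OF fin assms(2), of "\<lambda>_ _. 1::nat" "\<lambda>f x. \<forall>u\<in>U x. f u = 0"] by simp
  then have "(\<Sum>f\<in>?F. card {x \<in> A. \<forall>u\<in>U x. f u = 0}) * q ^ r =
      (\<Sum>x\<in>A. card {f \<in> ?F. \<forall>u\<in>U x. f u = 0} * q ^ card (U x))"
    using assms by (simp add: sum_distrib_right)
  also have "\<dots> = (\<Sum>x\<in>A. q ^ card V)"
    by (intro sum.cong refl card_colourings_fixing) (use assms in auto)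
  finally show ?thesis by simp
qed

context geometric_graph
begin

text \<open>The crossing inequality, obtained by averaging the previous bound over the subgraphs induced
  by a random set of vertices that contains each vertex with probability \<open>1 / q\<close>.\<close>

lemma crossing_inequality:
  assumes q: "0 < q"
  shows "card E * q ^ 2 \<le> 4 * card V * q ^ 3 + card crossings"
proof -
  let ?F = "V \<rightarrow>\<^sub>E {..<q}"
  let ?Q = "q ^ card V"
  \<comment> \<open>The singleton \<open>{v}\<close> gives vertices the same form as edges and
    crossings, so that one averaging lemma serves all three.\<close>
  define Vf where "Vf f = {v \<in> V. \<forall>u\<in>{v}. f u = 0}" for f :: "'v \<Rightarrow> nat"
  define Ef where "Ef f = {e \<in> E. \<forall>u\<in>{fst e, snd e}. f u = 0}" for f :: "'v \<Rightarrow> nat"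
  define Cf where "Cf f = {c \<in> crossings. \<forall>u\<in>{fst (fst c), snd (fst c), fst (snd c), snd (snd c)}. f u = 0}"
    for f :: "'v \<Rightarrow> nat"
  have V: "(\<Sum>f\<in>?F. card (Vf f)) * q ^ 1 = card V * ?Q"
    unfolding Vf_def by (rule sum_card_colourings) (use finite_vertices q in auto)
  have E: "(\<Sum>f\<in>?F. card (Ef f)) * q ^ 2 = card E * ?Q"
    unfolding Ef_def
    by (rule sum_card_colourings) (use finite_vertices finite_edges edge q in \<open>force simp: card_insert_if\<close>)+
  have C: "(\<Sum>f\<in>?F. card (Cf f)) * q ^ 4 = card crossings * ?Q"
    unfolding Cf_def
  proof (rule sum_card_colourings[OF finite_vertices finite_crossings q])
    fix c assume "c \<in> crossings"
    then show "{fst (fst c), snd (fst c), fst (snd c), snd (snd c)} \<subseteq> V \<and>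
        card {fst (fst c), snd (fst c), fst (snd c), snd (snd c)} = 4"
      using crossing_distinct[of "fst c" "snd c"] edge[of "fst c"] edge[of "snd c"]
      by (auto simp: crossings_def)
  qed
  have "card (Ef f) \<le> 4 * card (Vf f) + card (Cf f)" for f
  proof -
    interpret G: geometric_graph X Y "Vf f" "Ef f"
      by (rule subgraph) (use edge in \<open>auto simp: Vf_def Ef_def\<close>)
    have "G.crossings = Cf f"
      unfolding G.crossings_def crossings_def Cf_def by (auto simp: Ef_def)
    then show ?thesis using G.card_edges_le_crossings by simp
  qed
  then have "(\<Sum>f\<in>?F. card (Ef f)) \<le> 4 * (\<Sum>f\<in>?F. card (Vf f)) + (\<Sum>f\<in>?F. card (Cf f))"
    by (simp add: sum_distrib_left sum.distrib[symmetric] sum_mono)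
  then have "(\<Sum>f\<in>?F. card (Ef f)) * q ^ 4 \<le> (4 * (\<Sum>f\<in>?F. card (Vf f)) + (\<Sum>f\<in>?F. card (Cf f))) * q ^ 4"
    by (rule mult_right_mono) simp
  also have "\<dots> = 4 * ((\<Sum>f\<in>?F. card (Vf f)) * q ^ 1) * q ^ 3 + (\<Sum>f\<in>?F. card (Cf f)) * q ^ 4"
    by (simp add: algebra_simps power_numeral_reduce)
  also have "\<dots> = (4 * card V * q ^ 3 + card crossings) * ?Q"
    unfolding V C by (simp add: algebra_simps)
  also have "(\<Sum>f\<in>?F. card (Ef f)) * q ^ 4 = (\<Sum>f\<in>?F. card (Ef f)) * q ^ 2 * q ^ 2"
    by (simp add: power_numeral_reduce)
  also have "\<dots> = (card E * q ^ 2) * ?Q"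
    unfolding E by (simp add: algebra_simps)
  finally show ?thesis using q by simp
qed

end

lemma affine_root_between:
  fixes s c x z :: real
  assumes "s * x + c < 0" "0 < s * z + c"
  shows "s \<noteq> 0" "min x z < - c / s" "- c / s < max x z"
proof -
  show s: "s \<noteq> 0" using assms by auto
  have r: "s * (- c / s) = - c" using s by simp
  have "s * x < s * (- c / s)" "s * (- c / s) < s * z" unfolding r using assms by linarith+
  then show "min x z < - c / s" "- c / s < max x z"
    unfolding mult_less_cancel_left by (auto simp: min_def max_def)
qed

text \<open>The value \<open>q\<close> is about \<open>sqrt (8 * E) / k\<close>, chosen so that
  \<open>L ^ 2\<close>, which is at most \<open>4 * E ^ 2 / k ^ 2\<close>, takes no more than half
  of the left side. What remains is \<open>E \<le> 8 * N * q\<close>; the two summands of the result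
  correspond to small and large \<open>q\<close>.\<close>

lemma crossing_to_incidence_arith:
  fixes E N L k :: nat
  assumes k: "0 < k" and L: "L * k \<le> 2 * E"
    and q: "\<And>q. 0 < q \<Longrightarrow> E * q ^ 2 \<le> 4 * N * q ^ 3 + L ^ 2"
  shows "real E \<le> 16 * N + 2048 * N ^ 2 / k ^ 2"
proof (cases "E = 0")
  case False
  define r where "r = sqrt (8 * E) / k"
  define q where "q = nat \<lceil>r\<rceil>"
  have r: "0 < r" "r ^ 2 = 8 * E / k ^ 2" using False k by (auto simp: r_def power_divide)
  have qr: "0 < q" "r \<le> q" "q \<le> r + 1" using r by (auto simp: q_def)
  have "(real L * real k) ^ 2 \<le> (2 * real E) ^ 2"
    using of_nat_mono[OF L, where 'a = real] by (intro power_mono) auto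
  then have "real L ^ 2 \<le> E * r ^ 2 / 2" unfolding r(2) using k
    by (simp add: field_simps power2_eq_square)
  also have "\<dots> \<le> E * real q ^ 2 / 2" using qr r by (intro divide_right_mono mult_left_mono power_mono) auto
  finally have L2: "real L ^ 2 \<le> E * real q ^ 2 / 2" .
  have "real (E * q ^ 2) \<le> real (4 * N * q ^ 3 + L ^ 2)" using q[OF qr(1)] by (rule of_nat_mono)
  then have "real E * real q ^ 2 \<le> 8 * N * real q ^ 3" using L2 by simp
  then have "real E * real q ^ 2 \<le> (8 * N * real q) * real q ^ 2" by (simp add: power_numeral_reduce)
  then have "real E \<le> 8 * N * real q" using qr(1) by (simp add: mult_le_cancel_right)
  also have "\<dots> \<le> 8 * N * (r + 1)" using qr by (intro mult_left_mono) auto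
  finally have E: "real E \<le> 8 * N * (r + 1)" .
  show ?thesis
  proof (cases "r \<le> 1")
    case True
    have "8 * real N * (r + 1) \<le> 8 * real N * 2" using True by (intro mult_left_mono) auto
    then show ?thesis using E
      by (intro order.trans[OF _ add_increasing2[OF _ order.refl]]) auto
  next
    case False
    have "8 * real N * (r + 1) \<le> 8 * real N * (2 * r)" using False by (intro mult_left_mono) auto
    then have "real E \<le> 16 * N * r" using E by (simp add: algebra_simps)
    then have "real E ^ 2 \<le> (16 * N * r) ^ 2" by (intro power_mono) auto
    also have "\<dots> = 2048 * N ^ 2 / k ^ 2 * E" by (simp add: power_mult_distrib r(2))
    finally have "real E * E \<le> 2048 * N ^ 2 / k ^ 2 * E" by (simp only: power2_eq_square)
    then have "real E \<le> 2048 * N ^ 2 / k ^ 2"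
      by (rule mult_right_le_imp_le) (use \<open>E \<noteq> 0\<close> in simp)
    then show ?thesis by simp
  qed
qed simp

section \<open>Rich lines\<close>

locale planar_points =
  fixes X Y :: "'v \<Rightarrow> real" and P :: "'v set"
  assumes finite_points: "finite P" and inj_points: "inj_on X P"
begin

text \<open>A line is given by its slope and intercept; no line through two points of \<open>P\<close> is vertical
  because \<open>X\<close> is injective on \<open>P\<close>.\<close>

definition on_line :: "real \<times> real \<Rightarrow> 'v set" where
  "on_line l = {p \<in> P. Y p = fst l * X p + snd l}"

definition rich_lines :: "nat \<Rightarrow> (real \<times> real) set" where
  "rich_lines k = {l. k \<le> card (on_line l)}"

definition line_edges :: "real \<times> real \<Rightarrow> ('v \<times> 'v) set" where
  "line_edges l = {(a, b). a \<in> on_line l \<and> b \<in> on_line l \<and> X a < X b \<and>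
     (\<forall>p\<in>on_line l. \<not> (X a < X p \<and> X p < X b))}"

definition line_of :: "'v \<times> 'v \<Rightarrow> real \<times> real" where
  "line_of e = (slope X Y e, Y (fst e) - slope X Y e * X (fst e))"

lemma finite_on_line: "finite (on_line l)"
  using finite_points by (simp add: on_line_def)

lemma line_of_eq:
  assumes "a \<in> on_line l" "b \<in> on_line l" "X a < X b"
  shows "line_of (a, b) = l"
proof -
  have eq: "Y a = fst l * X a + snd l" "Y b = fst l * X b + snd l"
    using assms by (auto simp: on_line_def)
  have "Y b - Y a = fst l * (X b - X a)" using eq by (simp add: algebra_simps)
  then have "slope X Y (a, b) = fst l" using assms(3) by (simp add: slope_def)
  then show ?thesis using eq by (simp add: line_of_def prod_eq_iff)
qed

lemma height_line_of: "height X Y e x = fst (line_of e) * x + snd (line_of e)"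
  by (simp add: height_def line_of_def algebra_simps)

lemma line_of_line_edges: "e \<in> line_edges l \<Longrightarrow> line_of e = l"
  using line_of_eq[of "fst e" l "snd e"] by (auto simp: line_edges_def)

lemma finite_line_edges: "finite (line_edges l)"
  by (rule finite_subset[of _ "on_line l \<times> on_line l"]) (auto simp: line_edges_def finite_on_line)

text \<open>Every point of the line except the rightmost starts an edge to its successor.\<close>

lemma card_on_line_le: "card (on_line l) \<le> Suc (card (line_edges l))"
proof (cases "on_line l = {}")
  case False
  obtain M where M: "M \<in> on_line l" "\<forall>p\<in>on_line l. X p \<le> X M"
  proof -
    have fin: "finite (X ` on_line l)" "X ` on_line l \<noteq> {}" using False finite_on_line by auto
    then obtain M where "M \<in> on_line l" "X M = Max (X ` on_line l)" using Max_in[OF fin] by (metis imageE)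
    then show thesis using that Max_ge[OF fin(1)] by force
  qed
  have "on_line l \<subseteq> insert M (fst ` line_edges l)"
  proof
    fix a assume a: "a \<in> on_line l"
    show "a \<in> insert M (fst ` line_edges l)"
    proof (cases "a = M")
      case False
      define U where "U = {b \<in> on_line l. X a < X b}"
      have "X a \<noteq> X M" using False a M inj_points by (auto simp: on_line_def inj_on_def)
      then have "M \<in> U" using a M by (force simp: U_def)
      moreover have "finite U" using finite_on_line by (simp add: U_def)
      ultimately obtain b where b: "b \<in> U" "\<forall>c\<in>U. X b \<le> X c"
        by (metis arg_min_if_finite(1) arg_min_least empty_iff)
      then have "(a, b) \<in> line_edges l" using a by (force simp: line_edges_def U_def)
      then show ?thesis by force
    qed simp
  qed
  then have "card (on_line l) \<le> card (insert M (fst ` line_edges l))"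
    by (rule card_mono[rotated]) (simp add: finite_line_edges)
  also have "\<dots> \<le> Suc (card (fst ` line_edges l))" 
    by (simp add: card_insert_if finite_line_edges)
  also have "\<dots> \<le> Suc (card (line_edges l))" by (simp add: card_image_le finite_line_edges)
  finally show ?thesis .
qed simp

lemma two_on_line:
  assumes "2 \<le> card (on_line l)"
  obtains a b where "a \<in> on_line l" "b \<in> on_line l" "X a < X b"
proof -
  obtain a b where ab: "a \<in> on_line l" "b \<in> on_line l" "a \<noteq> b"
  proof -
    obtain S where "S \<subseteq> on_line l" "card S = 2" using obtain_subset_with_card_n[OF assms] by blast
    then show thesis using that by (auto simp: card_2_iff)
  qed
  then have "X a \<noteq> X b" using inj_points by (auto simp: on_line_def inj_on_def)
  then show ?thesis using that ab by (meson linorder_less_linear)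
qed

lemma finite_rich_lines:
  assumes "2 \<le> k"
  shows "finite (rich_lines k)"
proof (rule finite_subset)
  show "rich_lines k \<subseteq> line_of ` (P \<times> P)"
  proof
    fix l assume "l \<in> rich_lines k"
    then have "2 \<le> card (on_line l)" using assms by (simp add: rich_lines_def)
    then obtain a b where "a \<in> on_line l" "b \<in> on_line l" "X a < X b" by (rule two_on_line)
    then show "l \<in> line_of ` (P \<times> P)"
      using line_of_eq[of a l b] by (auto simp: on_line_def intro!: image_eqI[of _ _ "(a, b)"])
  qed
qed (simp add: finite_points)

lemma geometric_graph_rich:
  "geometric_graph X Y P (\<Union>l\<in>rich_lines k. line_edges l)"
proof
  show "finite P" "inj_on X P" by (fact finite_points inj_points)+
next
  fix e assume "e \<in> (\<Union>l\<in>rich_lines k. line_edges l)"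
  then show "fst e \<in> P \<and> snd e \<in> P \<and> X (fst e) < X (snd e)"
    by (auto simp: line_edges_def on_line_def)
next
  fix e v assume e: "e \<in> (\<Union>l\<in>rich_lines k. line_edges l)" and v: "v \<in> P"
    "X (fst e) < X v" "X v < X (snd e)"
  then obtain l where l: "e \<in> line_edges l" by blast
  show "height X Y e (X v) \<noteq> Y v"
  proof
    assume "height X Y e (X v) = Y v"
    then have "v \<in> on_line l" using v line_of_line_edges[OF l] height_line_of[of e "X v"]
      by (simp add: on_line_def)
    then show False using l v by (auto simp: line_edges_def)
  qed
qed

text \<open>The abscissa \<open>x\<close> depends only on the two lines, which is what bounds the
  crossings by pairs of lines.\<close>

lemma crossing_root:
  assumes "crossing X Y e f"
  defines "x \<equiv> - (snd (line_of e) - snd (line_of f)) / (fst (line_of e) - fst (line_of f))"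
  shows "X (fst e) < x \<and> x < X (snd e) \<and> X (fst f) < x \<and> x < X (snd f)"
proof -
  obtain y z where y: "X (fst e) \<le> y" "y \<le> X (snd e)" "X (fst f) \<le> y" "y \<le> X (snd f)"
      "height X Y e y < height X Y f y"
    and z: "X (fst e) \<le> z" "z \<le> X (snd e)" "X (fst f) \<le> z" "z \<le> X (snd f)"
      "height X Y f z < height X Y e z"
    using assms(1) by (auto simp: crossing_def spans_def)
  have "(fst (line_of e) - fst (line_of f)) * y + (snd (line_of e) - snd (line_of f)) < 0"
    "0 < (fst (line_of e) - fst (line_of f)) * z + (snd (line_of e) - snd (line_of f))"
    using y(5) z(5) unfolding height_line_of by (simp_all add: algebra_simps)
  from affine_root_between(2,3)[OF this] show ?thesis
    using y z unfolding x_def by auto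
qed

lemma line_edges_eqI:
  assumes "e \<in> line_edges l" "e' \<in> line_edges l"
    "X (fst e) < x" "x < X (snd e)" "X (fst e') < x" "x < X (snd e')"
  shows "e = e'"
proof -
  have "\<not> X (fst e) < X (fst e')" "\<not> X (fst e') < X (fst e)"
    "\<not> X (snd e) < X (snd e')" "\<not> X (snd e') < X (snd e)"
    using assms by (fastforce simp: line_edges_def)+
  then have "X (fst e) = X (fst e')" "X (snd e) = X (snd e')" by auto
  moreover have "fst e \<in> P" "fst e' \<in> P" "snd e \<in> P" "snd e' \<in> P"
    using assms(1,2) by (auto simp: line_edges_def on_line_def)
  ultimately show ?thesis using inj_onD[OF inj_points] by (simp add: prod_eq_iff)
qed

text \<open>The Szemeredi-Trotter bound: the graph of consecutive points on rich lines has few crossings,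
  since two lines meet only once, so by the crossing inequality it has few edges.\<close>

lemma sum_rich_lines_le:
  assumes k: "2 \<le> k"
  shows "real (\<Sum>l\<in>rich_lines k. card (on_line l)) \<le> 32 * card P + 4096 * card P ^ 2 / k ^ 2"
proof -
  let ?L = "rich_lines k"
  define E where "E = (\<Union>l\<in>?L. line_edges l)"
  interpret G: geometric_graph X Y P E unfolding E_def by (rule geometric_graph_rich)
  have fin: "finite ?L" using k by (rule finite_rich_lines)
  have "card E = (\<Sum>l\<in>?L. card (line_edges l))" unfolding E_def
    by (rule card_UN_disjoint) (use fin finite_line_edges line_of_line_edges in blast)+
  \<comment> \<open>A line with at least two points has at least half as many edges as
    points.\<close>
  moreover have "card (on_line l) \<le> 2 * card (line_edges l)" if "l \<in> ?L" for l
    using card_on_line_le[of l] that k by (simp add: rich_lines_def)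
  ultimately have sum: "(\<Sum>l\<in>?L. card (on_line l)) \<le> 2 * card E"
    by (simp add: sum_distrib_left sum_mono)
  have "card ?L * k \<le> (\<Sum>l\<in>?L. card (on_line l))"
    using sum_bounded_below[of ?L k "\<lambda>l. card (on_line l)"] by (simp add: rich_lines_def)
  then have L: "card ?L * k \<le> 2 * card E" using sum by simp
  \<comment> \<open>The two lines determine where they meet, and on each line only one edge has that
    abscissa in its interior.\<close>
  have "inj_on (\<lambda>(e, f). (line_of e, line_of f)) G.crossings"
  proof (rule inj_onI, clarify, rule conjI)
    fix e f e' f'
    assume ef: "(e, f) \<in> G.crossings" "(e', f') \<in> G.crossings"
      and eq: "line_of e = line_of e'" "line_of f = line_of f'"
    have "e \<in> E" "f \<in> E" "e' \<in> E" "f' \<in> E" using ef by (auto simp: G.crossings_def)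
    then obtain l1 l2 l1' l2' where l: "e \<in> line_edges l1" "f \<in> line_edges l2"
       "e' \<in> line_edges l1'" "f' \<in> line_edges l2'"
      unfolding E_def by blast
    then have l': "e' \<in> line_edges l1" "f' \<in> line_edges l2" using eq line_of_line_edges by metis+
    have c: "crossing X Y e f" "crossing X Y e' f'" using ef by (auto simp: G.crossings_def)
    note r = crossing_root[OF c(1)] and r' = crossing_root[OF c(2), folded eq]
    show "e = e'" using line_edges_eqI[OF l(1) l'(1)] r r' by blast
    show "f = f'" using line_edges_eqI[OF l(2) l'(2)] r r' by blast
  qed
  moreover have "line_of e \<in> ?L" if "e \<in> E" for e
    using that line_of_line_edges unfolding E_def by blast
  then have "(\<lambda>(e, f). (line_of e, line_of f)) ` G.crossings \<subseteq> ?L \<times> ?L"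
    by (auto simp: G.crossings_def)
  ultimately have "card G.crossings \<le> card (?L \<times> ?L)"
    by (rule card_inj_on_le) (use fin in simp)
  then have C: "card G.crossings \<le> card ?L ^ 2"
    by (simp add: card_cartesian_product power2_eq_square)
  have "real (card E) \<le> 16 * card P + 2048 * card P ^ 2 / k ^ 2"
  proof (rule crossing_to_incidence_arith[OF _ L])
    show "card E * q ^ 2 \<le> 4 * card P * q ^ 3 + card ?L ^ 2" if "0 < q" for q
      using G.crossing_inequality[OF that] C by linarith
  qed (use k in simp)
  then show ?thesis using of_nat_mono[OF sum, where 'a = real] by simp
qed

end

text \<open>Greedy choice from the left: take the first point \<open>g\<close> that completes
  \<open>k\<close> points, discard everything up to \<open>g\<close>, and repeat. Each chosen point
  uses up \<open>k\<close> points. An interval missing \<open>g\<close> has fewer than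
  \<open>k\<close> points if it lies to the left, and is left to the recursion if it lies to the
  right.\<close>

lemma (in planar_points) hitting_set:
  assumes "0 < k" and "A \<subseteq> P"
  shows "\<exists>G\<subseteq>A. card G * k \<le> card A \<and>
    (\<forall>x y. k \<le> card {a \<in> A. x \<le> X a \<and> X a \<le> y} \<longrightarrow> (\<exists>g\<in>G. x \<le> X g \<and> X g \<le> y))"
  using assms(2)
proof (induction "card A" arbitrary: A rule: less_induct)
  case less
  have finA: "finite A" using less.prems finite_points finite_subset by blast
  show ?case
  proof (cases "k \<le> card A")
    case False
    have "\<not> k \<le> card {a \<in> A. x \<le> X a \<and> X a \<le> y}" for x y
      using False card_mono[OF finA, of "{a \<in> A. x \<le> X a \<and> X a \<le> y}"] by auto
    then show ?thesis by (intro exI[of _ "{}"]) auto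
  next
    case True
    define H where "H = {g \<in> A. k \<le> card {a \<in> A. X a \<le> X g}}"
    have max: "\<exists>M\<in>B. \<forall>a\<in>B. X a \<le> X M" if "B \<noteq> {}" "B \<subseteq> A" for B
    proof -
      have fin: "finite (X ` B)" "X ` B \<noteq> {}" using that finA finite_subset by auto
      then obtain M where "M \<in> B" "X M = Max (X ` B)" using Max_in[OF fin] by (metis imageE)
      then show ?thesis using Max_ge[OF fin(1)] by force
    qed
    have "A \<noteq> {}" using True assms(1) by auto
    then obtain M where M: "M \<in> A" "\<forall>a\<in>A. X a \<le> X M" using max by blast
    then have "{a \<in> A. X a \<le> X M} = A" by auto
    then have "M \<in> H" using M True by (simp add: H_def)
    moreover have "finite H" using finA by (simp add: H_def)
    ultimately obtain g where g: "g \<in> H" "\<forall>h\<in>H. X g \<le> X h"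
      by (metis arg_min_if_finite(1) arg_min_least empty_iff)
    have below: "card {a \<in> A. X a < X g} < k"
    proof (rule ccontr)
      assume "\<not> card {a \<in> A. X a < X g} < k"
      then have le: "k \<le> card {a \<in> A. X a < X g}" by simp
      then have "{a \<in> A. X a < X g} \<noteq> {}" using assms(1) by (intro notI) simp
      then obtain m where m: "m \<in> A" "X m < X g" "\<forall>a\<in>{a \<in> A. X a < X g}. X a \<le> X m"
        using max[of "{a \<in> A. X a < X g}"] by auto
      then have "{a \<in> A. X a < X g} = {a \<in> A. X a \<le> X m}" by auto
      then have "m \<in> H" using m le by (simp add: H_def)
      then show False using g m by auto
    qed
    define A' where "A' = {a \<in> A. X g < X a}"
    have "A = {a \<in> A. X a \<le> X g} \<union> A'" by (auto simp: A'_def)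
    moreover have "card ({a \<in> A. X a \<le> X g} \<union> A') = card {a \<in> A. X a \<le> X g} + card A'"
      by (rule card_Un_disjoint) (use finA in \<open>auto simp: A'_def\<close>)
    ultimately have card: "k + card A' \<le> card A" using g by (simp add: H_def)
    then have "card A' < card A" using assms(1) by simp
    then obtain G where G: "G \<subseteq> A'" "card G * k \<le> card A'"
      "\<And>x y. k \<le> card {a \<in> A'. x \<le> X a \<and> X a \<le> y} \<Longrightarrow> \<exists>g\<in>G. x \<le> X g \<and> X g \<le> y"
      using less.hyps[of A'] less.prems by (auto simp: A'_def)
    show ?thesis
    proof (intro exI[of _ "insert g G"] conjI allI impI)
      show "insert g G \<subseteq> A" using g G by (auto simp: H_def A'_def)
      have "finite G" using G(1) finA by (auto simp: A'_def intro: finite_subset)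
      then have "card (insert g G) \<le> Suc (card G)" by (simp add: card_insert_if)
      then have "card (insert g G) * k \<le> Suc (card G) * k" by (rule mult_right_mono) simp
      also have "\<dots> \<le> card A" using G(2) card by simp
      finally show "card (insert g G) * k \<le> card A" .
      fix x y assume *: "k \<le> card {a \<in> A. x \<le> X a \<and> X a \<le> y}"
      consider "x \<le> X g \<and> X g \<le> y" | "y < X g" | "X g < x" by linarith
      then show "\<exists>g\<in>insert g G. x \<le> X g \<and> X g \<le> y"
      proof cases
        case 2
        then have "card {a \<in> A. x \<le> X a \<and> X a \<le> y} \<le> card {a \<in> A. X a < X g}"
          by (intro card_mono) (use finA in auto)
        then show ?thesis using * below by simp
      next
        case 3
        then have "{a \<in> A. x \<le> X a \<and> X a \<le> y} = {a \<in> A'. x \<le> X a \<and> X a \<le> y}"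
          by (auto simp: A'_def)
        then show ?thesis using * G(3) by auto
      qed simp
    qed
  qed
qed

section \<open>Lattice segments, rays and pivots\<close>

definition lattice_segment :: "point \<Rightarrow> point \<Rightarrow> point set" where
  "lattice_segment x y = {p. between (to_plane x, to_plane y) (to_plane p)}"

definition ray :: "point \<times> point \<Rightarrow> nat \<Rightarrow> point" where
  "ray r j = (fst (fst r) + int j * fst (snd r), snd (fst r) + int j * snd (snd r))"

lemma mem_lattice_segment:
  fixes x y p :: point
  shows "p \<in> lattice_segment x y \<longleftrightarrow> (\<exists>u::real. 0 \<le> u \<and> u \<le> 1 \<and>
     real_of_int (fst p) = (1 - u) * fst x + u * fst y \<and>
     real_of_int (snd p) = (1 - u) * snd x + u * snd y)"
  by (auto simp: lattice_segment_def between_mem_segment closed_segment_def to_plane_def)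

text \<open>Translates betweenness in the plane into a line equation with an interval of abscissae,
  the form in which rich lines and hitting sets are stated.\<close>

lemma lattice_segment_line:
  fixes x y p :: point and s :: real
  assumes "fst x \<noteq> fst y"
  defines "s \<equiv> (real_of_int (snd y) - snd x) / (fst y - fst x)"
  shows "p \<in> lattice_segment x y \<longleftrightarrow>
    real_of_int (snd p) = s * fst p + (snd x - s * fst x) \<and>
    min (fst x) (fst y) \<le> real_of_int (fst p) \<and> real_of_int (fst p) \<le> max (fst x) (fst y)"
    (is "_ \<longleftrightarrow> ?R")
proof
  let ?D = "real_of_int (fst y) - fst x"
  have D: "?D \<noteq> 0" using assms by simp
  have sD: "s * ?D = real_of_int (snd y) - snd x" using D by (simp add: s_def)
  {
    assume "p \<in> lattice_segment x y"
    then obtain u :: real where u: "0 \<le> u" "u \<le> 1"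
      "real_of_int (fst p) = fst x + u * ?D"
      "real_of_int (snd p) = snd x + u * (real_of_int (snd y) - snd x)"
      unfolding mem_lattice_segment by (auto simp: algebra_simps)
    have "real_of_int (snd p) = s * fst p + (snd x - s * fst x)"
      unfolding u(3,4) sD[symmetric] by (simp add: algebra_simps)
    moreover have "min 0 ?D \<le> u * ?D \<and> u * ?D \<le> max 0 ?D"
    proof (cases "0 \<le> ?D")
      case True
      then show ?thesis using u mult_left_le_one_le[of ?D u] by simp
    next
      case False
      then show ?thesis using u mult_left_le_one_le[of "- ?D" u]
        by (simp add: mult_nonneg_nonpos)
    qed
    moreover have "real_of_int (min (fst x) (fst y)) = fst x + min 0 ?D"
      "real_of_int (max (fst x) (fst y)) = fst x + max 0 ?D"
      by (auto simp: min_def max_def)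
    ultimately show ?R using u(3) by (simp add: of_int_min of_int_max)
  }
  assume R: ?R
  define u where "u = (real_of_int (fst p) - fst x) / ?D"
  have uD: "u * ?D = real_of_int (fst p) - fst x" using D by (simp add: u_def)
  have "0 \<le> u \<and> u \<le> 1"
  proof (cases "0 < ?D")
    case True
    then show ?thesis using R by (simp add: u_def field_simps)
  next
    case False
    then have "?D < 0" using D by simp
    then show ?thesis using R by (simp add: u_def field_simps)
  qed
  moreover have "real_of_int (snd p) = snd x + s * (u * ?D)"
    using R unfolding uD by (simp add: algebra_simps)
  then have "real_of_int (snd p) = snd x + u * (s * ?D)" by (simp add: algebra_simps)
  ultimately show "p \<in> lattice_segment x y"
    unfolding mem_lattice_segment sD by (intro exI[of _ u]) (use uD in \<open>auto simp: algebra_simps\<close>)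
qed

text \<open>Divide \<open>w\<close> by the gcd of its coordinates and apply Bezout. A primitive
  direction is essential: the steps of a ray must not skip any lattice point of the line, since
  Maker could play there.\<close>

lemma primitive_direction:
  fixes w :: point
  assumes "w \<noteq> (0, 0)"
  shows "\<exists>d. d \<noteq> (0, 0) \<and> (\<forall>v::point. fst v * snd w = snd v * fst w \<longrightarrow>
    (\<exists>j. v = (j * fst d, j * snd d)))"
proof -
  define g where "g = gcd (fst w) (snd w)"
  have g: "g \<noteq> 0" using assms by (auto simp: g_def prod_eq_iff)
  obtain a b where ab: "fst w = g * a" "snd w = g * b" unfolding g_def by (meson dvdE gcd_dvd1 gcd_dvd2)
  obtain s t where "s * fst w + t * snd w = g" unfolding g_def using bezout_int by blast
  then have "g * (s * a + t * b) = g" by (simp add: ab algebra_simps)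
  then have st: "s * a + t * b = 1" using g by simp
  show ?thesis
  proof (intro exI[of _ "(a, b)"] conjI allI impI)
    show "(a, b) \<noteq> (0, 0)" using st by auto
    fix v :: point assume "fst v * snd w = snd v * fst w"
    then have "g * (fst v * b) = g * (snd v * a)" by (simp add: ab algebra_simps)
    then have v: "fst v * b = snd v * a" using g by simp
    have "fst v = fst v * (s * a + t * b)" using st by simp
    also have "\<dots> = s * fst v * a + t * (fst v * b)" by (simp add: algebra_simps)
    finally have 1: "fst v = (s * fst v + t * snd v) * a" unfolding v by (simp add: algebra_simps)
    have "snd v = snd v * (s * a + t * b)" using st by simp
    also have "\<dots> = s * (snd v * a) + t * snd v * b" by (simp add: algebra_simps)
    finally have 2: "snd v = (s * fst v + t * snd v) * b" unfolding v[symmetric] by (simp add: algebra_simps)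
    show "\<exists>j. v = (j * fst (a, b), j * snd (a, b))"
      using 1 2 by (intro exI[of _ "s * fst v + t * snd v"]) (simp add: prod_eq_iff)
  qed
qed

text \<open>A pivot is a point of \<open>P\<close> together with a primitive direction. However many points \<open>u\<close> could
  extend a segment that is rich in \<open>P\<close>, each of them lies on a ray of one of the few pivots.\<close>

definition pivots :: "point set \<Rightarrow> nat \<Rightarrow> (point \<times> point) set \<Rightarrow> bool" where
  "pivots P k Q \<longleftrightarrow> finite Q \<and> (\<forall>r\<in>Q. snd r \<noteq> (0, 0)) \<and>
    real (card Q) \<le> 64 * real (card P) / real k + 8192 * real (card P) ^ 2 / real k ^ 3 \<and>
    (\<forall>x y u. k \<le> card (P \<inter> lattice_segment x y) \<longrightarrow> u \<in> lattice_segment x y \<longrightarrow> u \<notin> P \<longrightarrow>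
      (\<exists>r\<in>Q. fst r \<in> lattice_segment x y \<and> (\<exists>j. u = ray r j)))"

text \<open>The pivots are the hitting sets of the rich lines. Their total size is the number of
  incidences divided by \<open>k\<close>, which the Szemeredi-Trotter bound controls.\<close>

lemma pivots_exist_inj:
  fixes P :: "point set"
  assumes fin: "finite P" and inj: "inj_on fst P" and k: "2 \<le> k"
  shows "\<exists>Q. pivots P k Q"
proof -
  define X Y :: "point \<Rightarrow> real" where "X = (\<lambda>p. real_of_int (fst p))" and "Y = (\<lambda>p. real_of_int (snd p))"
  interpret planar_points X Y P
    by unfold_locales (use fin inj in \<open>auto simp: X_def inj_on_def\<close>)
  let ?L = "rich_lines k"
  have on_lineP: "on_line l \<subseteq> P" for l by (auto simp: on_line_def)
  define hits where "hits l G \<longleftrightarrow> G \<subseteq> on_line l \<and> card G * k \<le> card (on_line l) \<and>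
     (\<forall>x y. k \<le> card {a \<in> on_line l. x \<le> X a \<and> X a \<le> y} \<longrightarrow> (\<exists>g\<in>G. x \<le> X g \<and> X g \<le> y))" for l G
  have "\<forall>l. \<exists>G. hits l G"
    using hitting_set[of k, OF _ on_lineP] k by (simp add: hits_def)
  then obtain G where "\<forall>l. hits l (G l)" by metis
  then have G: "\<And>l. G l \<subseteq> on_line l" "\<And>l. card (G l) * k \<le> card (on_line l)"
    "\<And>l x y. k \<le> card {a \<in> on_line l. x \<le> X a \<and> X a \<le> y} \<Longrightarrow> \<exists>g\<in>G l. x \<le> X g \<and> X g \<le> y"
    unfolding hits_def by blast+
  define dir where "dir l d \<longleftrightarrow> d \<noteq> (0, 0) \<and>
      (\<forall>p q. Y p = fst l * X p + snd l \<longrightarrow> Y q = fst l * X q + snd l \<longrightarrow>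
      (\<exists>j. q = (fst p + j * fst d, snd p + j * snd d)))" for l d
  have "\<exists>d. dir l d" if "l \<in> ?L" for l
  proof -
    have "2 \<le> card (on_line l)" using that k by (simp add: rich_lines_def)
    then obtain a b where ab: "a \<in> on_line l" "b \<in> on_line l" "X a < X b" by (rule two_on_line)
    define w where "w = (fst b - fst a, snd b - snd a)"
    have w: "w \<noteq> (0, 0)" using ab by (auto simp: w_def X_def)
    have "Y a = fst l * X a + snd l" "Y b = fst l * X b + snd l" using ab by (auto simp: on_line_def)
    then have Yw: "real_of_int (snd w) = fst l * real_of_int (fst w)"
      by (simp add: w_def X_def Y_def algebra_simps)
    obtain d where d: "d \<noteq> (0, 0)" "\<And>v::point. fst v * snd w = snd v * fst w \<Longrightarrow>
        \<exists>j. v = (j * fst d, j * snd d)"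
      using primitive_direction[OF w] by blast
    show ?thesis unfolding dir_def
    proof (intro exI[of _ d] conjI allI impI d(1))
      fix p q assume pq: "Y p = fst l * X p + snd l" "Y q = fst l * X q + snd l"
      let ?v = "(fst q - fst p, snd q - snd p)"
      have "real_of_int (snd ?v) = fst l * real_of_int (fst ?v)"
        using pq by (simp add: X_def Y_def algebra_simps)
      then have "real_of_int (fst ?v * snd w) = real_of_int (snd ?v * fst w)"
        unfolding of_int_mult Yw by simp
      then have "fst ?v * snd w = snd ?v * fst w" by (simp only: of_int_eq_iff)
      then obtain j where "?v = (j * fst d, j * snd d)" using d(2) by blast
      then show "\<exists>j. q = (fst p + j * fst d, snd p + j * snd d)"
        by (intro exI[of _ j]) (auto simp: prod_eq_iff)
    qed
  qed
  then obtain d where "\<forall>l\<in>?L. dir l (d l)" by metis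
  then have d: "\<And>l. l \<in> ?L \<Longrightarrow> d l \<noteq> (0, 0)"
    "\<And>l p q. l \<in> ?L \<Longrightarrow> Y p = fst l * X p + snd l \<Longrightarrow> Y q = fst l * X q + snd l \<Longrightarrow>
      \<exists>j. q = (fst p + j * fst (d l), snd p + j * snd (d l))"
    unfolding dir_def by blast+
  \<comment> \<open>A ray is only a half-line, so both orientations are listed. This doubles the
    constants 32 and 4096 to 64 and 8192.\<close>
  define Q where "Q = (\<Union>l\<in>?L. G l \<times> {d l, (- fst (d l), - snd (d l))})"
  have finL: "finite ?L" using k by (rule finite_rich_lines)
  have finG: "finite (G l)" for l using G(1) finite_on_line finite_subset by blast
  have "pivots P k Q"
    unfolding pivots_def
  proof (intro conjI allI impI)
    show "finite Q" using finL finG by (auto simp: Q_def)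
    show "\<forall>r\<in>Q. snd r \<noteq> (0, 0)" using d(1) by (auto simp: Q_def prod_eq_iff)
    have "card Q \<le> (\<Sum>l\<in>?L. card (G l \<times> {d l, (- fst (d l), - snd (d l))}))"
      unfolding Q_def by (rule card_UN_le[OF finL])
    also have "\<dots> \<le> (\<Sum>l\<in>?L. 2 * card (G l))"
      by (intro sum_mono) (auto simp: card_cartesian_product card_insert_if)
    finally have "card Q * k \<le> (\<Sum>l\<in>?L. 2 * card (G l)) * k" by (rule mult_right_mono) simp
    also have "\<dots> = (\<Sum>l\<in>?L. 2 * (card (G l) * k))" by (simp add: sum_distrib_right mult.assoc)
    also have "\<dots> \<le> (\<Sum>l\<in>?L. 2 * card (on_line l))" by (intro sum_mono mult_left_mono G(2)) simp
    also have "\<dots> = 2 * (\<Sum>l\<in>?L. card (on_line l))" by (simp add: sum_distrib_left)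
    finally have "real (card Q * k) \<le> real (2 * (\<Sum>l\<in>?L. card (on_line l)))" by (rule of_nat_mono)
    then have "real (card Q) * k \<le> 64 * card P + 8192 * card P ^ 2 / k ^ 2"
      using sum_rich_lines_le[OF k] by simp
    then show "real (card Q) \<le> 64 * real (card P) / real k + 8192 * real (card P) ^ 2 / real k ^ 3"
      using k by (simp add: field_simps power_numeral_reduce)
  next
    fix x y u
    assume card: "k \<le> card (P \<inter> lattice_segment x y)" and u: "u \<in> lattice_segment x y" "u \<notin> P"
    \<comment> \<open>Two points of \<open>P\<close> on the segment have different abscissae, so the
      segment is not vertical and lies on a line given by slope and intercept.\<close>
    have "2 \<le> card (P \<inter> lattice_segment x y)" using card k by simp
    then obtain S where S: "S \<subseteq> P \<inter> lattice_segment x y" "card S = 2"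
      by (metis obtain_subset_with_card_n)
    then obtain a b where ab: "a \<in> P" "b \<in> P" "a \<noteq> b" "a \<in> lattice_segment x y" "b \<in> lattice_segment x y"
      by (auto simp: card_2_iff)
    then have ne: "fst a \<noteq> fst b" using inj by (auto simp: inj_on_def)
    have xy: "fst x \<noteq> fst y"
    proof
      assume "fst x = fst y"
      then have "real_of_int (fst a) = fst x" "real_of_int (fst b) = fst x"
        using ab(4,5) unfolding mem_lattice_segment by (auto simp: algebra_simps)
      then show False using ne by simp
    qed
    define s where "s = (real_of_int (snd y) - snd x) / (fst y - fst x)"
    define l where "l = (s, snd x - s * fst x)"
    define lo hi where "lo = real_of_int (min (fst x) (fst y))" and "hi = real_of_int (max (fst x) (fst y))"
    have seg: "p \<in> lattice_segment x y \<longleftrightarrow> Y p = fst l * X p + snd l \<and> lo \<le> X p \<and> X p \<le> hi" for p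
      using lattice_segment_line[OF xy, of p]
      by (simp add: l_def s_def X_def Y_def lo_def hi_def of_int_min of_int_max)
    have eq: "P \<inter> lattice_segment x y = {a \<in> on_line l. lo \<le> X a \<and> X a \<le> hi}"
      by (auto simp: seg on_line_def)
    have "k \<le> card (on_line l)"
      using card card_mono[OF finite_on_line, of "P \<inter> lattice_segment x y" l] unfolding eq by auto
    then have l: "l \<in> ?L" by (simp add: rich_lines_def)
    obtain g where g: "g \<in> G l" "lo \<le> X g" "X g \<le> hi" using G(3) card unfolding eq by blast
    have gl: "g \<in> on_line l" using g G(1) by blast
    then have gseg: "g \<in> lattice_segment x y" using g by (auto simp: seg on_line_def)
    obtain j where j: "u = (fst g + j * fst (d l), snd g + j * snd (d l))"
      using d(2)[OF l, of g u] gl u by (auto simp: on_line_def seg)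
    show "\<exists>r\<in>Q. fst r \<in> lattice_segment x y \<and> (\<exists>j. u = ray r j)"
    proof (cases "0 \<le> j")
      case True
      then have "u = ray (g, d l) (nat j)" using j by (simp add: ray_def)
      moreover have "(g, d l) \<in> Q" using l g by (auto simp: Q_def)
      ultimately show ?thesis using gseg by force
    next
      case False
      then have "u = ray (g, (- fst (d l), - snd (d l))) (nat (- j))" using j by (simp add: ray_def)
      moreover have "(g, (- fst (d l), - snd (d l))) \<in> Q" using l g by (auto simp: Q_def)
      ultimately show ?thesis using gseg by force
    qed
  qed
  then show ?thesis ..
qed

lemma pivots_exist:
  fixes P :: "point set"
  assumes fin: "finite P" and k: "2 \<le> k"
  shows "\<exists>Q. pivots P k Q"
proof -
  \<comment> \<open>The shear is unimodular, hence an automorphism of the lattice, and for large \<open>H\<close> it makes the first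
    coordinates of \<open>P\<close> distinct.\<close>
  define H where "H = 1 + (\<Sum>p\<in>P. 2 * \<bar>snd p\<bar>)"
  define \<phi> where "\<phi> p = (H * fst p + snd p, fst p)" for p :: point
  define \<psi> where "\<psi> p = (snd p, fst p - H * snd p)" for p :: point
  have \<psi>\<phi>: "\<psi> (\<phi> p) = p" and \<phi>\<psi>: "\<phi> (\<psi> p) = p" for p by (auto simp: \<phi>_def \<psi>_def)
  have inj\<phi>: "inj_on \<phi> A" for A by (metis \<psi>\<phi> inj_onI)
  have inj: "inj_on fst (\<phi> ` P)"
  proof (rule inj_onI)
    fix p' q' assume "p' \<in> \<phi> ` P" "q' \<in> \<phi> ` P" "fst p' = fst q'"
    then obtain p q where pq: "p \<in> P" "q \<in> P" and p': "p' = \<phi> p" "q' = \<phi> q"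
      and eq: "fst (\<phi> p) = fst (\<phi> q)" by blast
    have "2 * \<bar>snd p\<bar> < H" "2 * \<bar>snd q\<bar> < H"
      using member_le_sum[of p P "\<lambda>p. 2 * \<bar>snd p\<bar>"] member_le_sum[of q P "\<lambda>p. 2 * \<bar>snd p\<bar>"] pq fin
      by (auto simp: H_def)
    then have lt: "\<bar>snd q - snd p\<bar> < H" by linarith
    have dvd: "H * (fst p - fst q) = snd q - snd p" using eq by (simp add: \<phi>_def algebra_simps)
    have "fst p = fst q"
    proof (rule ccontr)
      assume "fst p \<noteq> fst q"
      then have "1 \<le> \<bar>fst p - fst q\<bar>" by linarith
      then have "\<bar>H\<bar> * 1 \<le> \<bar>H\<bar> * \<bar>fst p - fst q\<bar>" by (intro mult_left_mono) auto
      then show False using lt unfolding dvd[symmetric] abs_mult by linarith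
    qed
    then show "p' = q'" using eq p' by (simp add: \<phi>_def)
  qed
  have seg: "\<phi> p \<in> lattice_segment (\<phi> x) (\<phi> y) \<longleftrightarrow> p \<in> lattice_segment x y" for p x y
  proof
    assume "p \<in> lattice_segment x y"
    then obtain u :: real where u: "0 \<le> u" "u \<le> 1" "real_of_int (fst p) = (1 - u) * fst x + u * fst y"
     "real_of_int (snd p) = (1 - u) * snd x + u * snd y" unfolding mem_lattice_segment by blast
    have "real_of_int (H * fst p + snd p) = (1 - u) * (H * fst x + snd x) + u * (H * fst y + snd y)"
      by (simp add: u algebra_simps)
    then show "\<phi> p \<in> lattice_segment (\<phi> x) (\<phi> y)" unfolding mem_lattice_segment
      using u by (intro exI[of _ u]) (simp add: \<phi>_def)
  next
    assume "\<phi> p \<in> lattice_segment (\<phi> x) (\<phi> y)"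
    then obtain u :: real where "0 \<le> u" "u \<le> 1" and
     a: "real_of_int (fst p) = (1 - u) * fst x + u * fst y" and
     b: "H * real_of_int (fst p) + snd p = (1 - u) * (H * fst x + snd x) + u * (H * fst y + snd y)"
      unfolding mem_lattice_segment by (auto simp: \<phi>_def)
    moreover have "real_of_int (snd p) = (1 - u) * snd x + u * snd y"
      using b unfolding a by (simp add: algebra_simps)
    ultimately show "p \<in> lattice_segment x y" unfolding mem_lattice_segment by blast
  qed
  obtain Q' where "pivots (\<phi> ` P) k Q'" using pivots_exist_inj[OF _ inj k] fin by auto
  then have Q': "finite Q'" "\<forall>r\<in>Q'. snd r \<noteq> (0, 0)"
    "real (card Q') \<le> 64 * real (card P) / real k + 8192 * real (card P) ^ 2 / real k ^ 3"
    "\<And>x y u. k \<le> card (\<phi> ` P \<inter> lattice_segment x y) \<Longrightarrow> u \<in> lattice_segment x y \<Longrightarrow> u \<notin> \<phi> ` P \<Longrightarrow>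
      \<exists>r\<in>Q'. fst r \<in> lattice_segment x y \<and> (\<exists>j. u = ray r j)"
    by (auto simp: pivots_def card_image[OF inj\<phi>])
  have "pivots P k (map_prod \<psi> \<psi> ` Q')"
    unfolding pivots_def
  proof (intro conjI allI impI)
    show "finite (map_prod \<psi> \<psi> ` Q')" using Q'(1) by simp
    show "\<forall>r\<in>map_prod \<psi> \<psi> ` Q'. snd r \<noteq> (0, 0)" using Q'(2) by (auto simp: \<psi>_def)
    have "real (card (map_prod \<psi> \<psi> ` Q')) \<le> card Q'" using Q'(1) by (simp add: card_image_le)
    then show "real (card (map_prod \<psi> \<psi> ` Q')) \<le> 64 * real (card P) / real k + 8192 * real (card P) ^ 2 / real k ^ 3"
      using Q'(3) by linarith
  next
    fix x y u
    assume k: "k \<le> card (P \<inter> lattice_segment x y)" and u: "u \<in> lattice_segment x y" "u \<notin> P"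
    have "\<phi> ` P \<inter> lattice_segment (\<phi> x) (\<phi> y) = \<phi> ` (P \<inter> lattice_segment x y)"
      using seg by blast
    then have "k \<le> card (\<phi> ` P \<inter> lattice_segment (\<phi> x) (\<phi> y))" using k by (simp add: card_image[OF inj\<phi>])
    moreover have "\<phi> u \<in> lattice_segment (\<phi> x) (\<phi> y)" using u seg by simp
    moreover have "\<phi> u \<notin> \<phi> ` P" using u by (metis \<psi>\<phi> imageE)
    ultimately obtain r j where r: "r \<in> Q'" "fst r \<in> lattice_segment (\<phi> x) (\<phi> y)" "\<phi> u = ray r j"
      using Q'(4) by blast
    have "fst (map_prod \<psi> \<psi> r) \<in> lattice_segment x y" using r(2) seg[of "\<psi> (fst r)" x y] by (simp add: \<phi>\<psi>)
    moreover have "u = ray (map_prod \<psi> \<psi> r) j"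
      using arg_cong[OF r(3), of \<psi>] by (simp add: \<psi>\<phi>) (simp add: \<psi>_def ray_def algebra_simps)
    ultimately show "\<exists>r\<in>map_prod \<psi> \<psi> ` Q'. fst r \<in> lattice_segment x y \<and> (\<exists>j. u = ray r j)"
      using r(1) by blast
  qed
  then show ?thesis ..
qed

text \<open>By convexity: \<open>ray r i\<close> lies between the start of the ray and
  \<open>ray r j\<close>.\<close>

lemma ray_in_segment:
  assumes "fst r \<in> lattice_segment x y" "ray r j \<in> lattice_segment x y" "i \<le> j"
  shows "ray r i \<in> lattice_segment x y"
proof (cases "j = 0")
  case False
  have "to_plane (ray r i) = (1 - real i / j) *\<^sub>R to_plane (fst r) + (real i / j) *\<^sub>R to_plane (ray r j)"
    using False by (simp add: to_plane_def ray_def field_simps)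
  moreover have "to_plane (fst r) \<in> closed_segment (to_plane x) (to_plane y)"
    "to_plane (ray r j) \<in> closed_segment (to_plane x) (to_plane y)"
    using assms by (auto simp: lattice_segment_def between_mem_segment)
  ultimately have "to_plane (ray r i) \<in> closed_segment (to_plane x) (to_plane y)"
    using convexD_alt[OF convex_closed_segment, of "to_plane (fst r)" _ _ "to_plane (ray r j)" "real i / j"]
      assms False by simp
  then show ?thesis by (simp add: lattice_segment_def between_mem_segment)
qed (use assms in simp)

lemma inj_ray: "snd r \<noteq> (0, 0) \<Longrightarrow> inj (ray r)"
  by (auto simp: inj_def ray_def prod_eq_iff)

section \<open>Breaker's strategy\<close>

lemma length_play [simp]: "length (play \<sigma> \<beta> t) = t"
  by (induction t) (auto simp: Let_def)

lemma maker_points_Suc: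
  "maker_points (play \<sigma> \<beta> (Suc t)) = maker_points (play \<sigma> \<beta> t) \<union> \<sigma> (play \<sigma> \<beta> t)"
  by (auto simp: maker_points_def Let_def)

lemma breaker_points_Suc:
  "breaker_points (play \<sigma> \<beta> (Suc t)) =
    breaker_points (play \<sigma> \<beta> t) \<union> \<beta> (play \<sigma> \<beta> t) (\<sigma> (play \<sigma> \<beta> t))"
  by (auto simp: breaker_points_def Let_def)

lemma maker_points_play: "maker_points (play \<sigma> \<beta> t) = (\<Union>s<t. \<sigma> (play \<sigma> \<beta> s))"
proof (induction t)
  case (Suc t)
  then show ?case unfolding maker_points_Suc lessThan_Suc by auto
qed (simp add: maker_points_def)

lemma breaker_points_play:
  "breaker_points (play \<sigma> \<beta> t) = (\<Union>s<t. \<beta> (play \<sigma> \<beta> s) (\<sigma> (play \<sigma> \<beta> s)))"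
proof (induction t)
  case (Suc t)
  then show ?case unfolding breaker_points_Suc lessThan_Suc by auto
qed (simp add: breaker_points_def)

lemma map_fst_play: "map fst (play \<sigma> \<beta> t) = map (\<lambda>s. \<sigma> (play \<sigma> \<beta> s)) [0..<t]"
  by (induction t) (auto simp: Let_def)

lemma finite_claimed_play:
  assumes "maker_strategy m \<sigma>" "breaker_strategy b \<beta>"
  shows "finite (claimed (play \<sigma> \<beta> t))"
proof (induction t)
  case 0
  show ?case by (simp add: claimed_def maker_points_def breaker_points_def)
next
  case (Suc t)
  have M: "finite (\<sigma> (play \<sigma> \<beta> t))" using assms(1) Suc by (auto simp: maker_strategy_def)
  then have "finite (\<beta> (play \<sigma> \<beta> t) (\<sigma> (play \<sigma> \<beta> t)))"
    using assms(2) Suc by (auto simp: breaker_strategy_def)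
  then show ?case using Suc M unfolding claimed_def maker_points_Suc breaker_points_Suc by auto
qed

lemma claimed_play_mono: "s \<le> t \<Longrightarrow> claimed (play \<sigma> \<beta> s) \<subseteq> claimed (play \<sigma> \<beta> t)"
  unfolding claimed_def maker_points_play breaker_points_play by fastforce

section \<open>Dyadic windows of time\<close>

lemma finite_levels: "finite {i. 2 ^ i \<le> (t::nat)}"
proof (rule finite_subset)
  show "{i. 2 ^ i \<le> t} \<subseteq> {..t}"
  proof clarsimp
    fix i :: nat assume "2 ^ i \<le> t"
    then show "i \<le> t" using less_exp[of i] by linarith
  qed
qed simp

definition dyadic :: "nat \<Rightarrow> nat \<Rightarrow> nat set" where
  "dyadic i w = {w * 2 ^ i..<(w + 1) * 2 ^ i}"

text \<open>The first condition says that the window and the following one, used for blocking it,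
  are over before timestep \<open>t\<close> is. The second says that this fails for the window of
  twice the length that contains it, so the window has to be counted at this level.\<close>

definition recent_windows :: "nat \<Rightarrow> nat \<Rightarrow> nat set" where
  "recent_windows t i = {w. w + 2 \<le> t div 2 ^ i \<and> 2 * (t div 2 ^ Suc i - 1) \<le> w}"

lemma finite_recent_windows: "finite (recent_windows t i)"
  by (rule finite_subset[of _ "{..t div 2 ^ i}"]) (auto simp: recent_windows_def)

lemma card_recent_windows: "card (recent_windows t i) \<le> 2"
proof -
  have "t div 2 ^ Suc i = t div 2 ^ i div 2" by (simp only: power_Suc2 div_mult2_eq)
  then have "recent_windows t i \<subseteq> {2 * (t div 2 ^ Suc i - 1), 2 * (t div 2 ^ Suc i - 1) + 1}"
    by (auto simp: recent_windows_def)
  then have "card (recent_windows t i) \<le> card {2 * (t div 2 ^ Suc i - 1), 2 * (t div 2 ^ Suc i - 1) + 1}"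
    by (rule card_mono[rotated]) simp
  then show ?thesis by (simp add: card_insert_if split: if_splits)
qed

lemma recent_windows_le:
  assumes "w \<in> recent_windows t i"
  shows "(w + 2) * 2 ^ i \<le> t"
proof -
  have "(w + 2) * 2 ^ i \<le> t div 2 ^ i * 2 ^ i"
    using assms by (intro mult_right_mono) (auto simp: recent_windows_def)
  also have "\<dots> \<le> t" by simp
  finally show ?thesis .
qed

text \<open>Choose the greatest level at which the window of \<open>r\<close> is already blocked;
  level 0 qualifies because \<open>Suc r < t\<close>.\<close>

lemma dyadic_cover:
  assumes "Suc r < t"
  shows "\<exists>i w. 2 ^ i \<le> t \<and> w \<in> recent_windows t i \<and> r \<in> dyadic i w"
proof -
  let ?good = "\<lambda>i. r div 2 ^ i + 2 \<le> t div 2 ^ i"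
  have "finite {i. ?good i}"
  proof (rule finite_subset[OF _ finite_levels[of t]], clarify)
    fix i assume "?good i"
    then have "t div 2 ^ i \<noteq> 0" by linarith
    then show "2 ^ i \<le> t" by (metis div_less not_le)
  qed
  moreover have "?good 0" using assms by simp
  ultimately obtain i where i: "?good i" "\<And>j. ?good j \<Longrightarrow> j \<le> i"
    using Max_in[of "{i. ?good i}"] Max_ge[of "{i. ?good i}"] by blast
  have "\<not> ?good (Suc i)" using i(2)[of "Suc i"] by auto
  moreover have "r div 2 ^ Suc i = r div 2 ^ i div 2" by (simp only: power_Suc2 div_mult2_eq)
  ultimately have "2 * (t div 2 ^ Suc i - 1) \<le> r div 2 ^ i" by linarith
  then have "r div 2 ^ i \<in> recent_windows t i" using i by (simp add: recent_windows_def)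
  moreover have "r \<in> dyadic i (r div 2 ^ i)"
    using div_times_less_eq_dividend[of r "2 ^ i"] dividend_less_div_times[of "2 ^ i" r]
    by (simp add: dyadic_def add.commute)
  moreover have "2 ^ i \<le> t"
  proof -
    have "t div 2 ^ i \<noteq> 0" using i(1) by linarith
    then show ?thesis by (metis div_less not_le)
  qed
  ultimately show ?thesis by blast
qed

section \<open>Distributing the pivots and answering them\<close>

lemma
  assumes "pivots P k Q"
  shows pivots_finite: "finite Q"
    and pivots_direction: "r \<in> Q \<Longrightarrow> snd r \<noteq> (0, 0)"
    and pivots_hit: "k \<le> card (P \<inter> lattice_segment x y) \<Longrightarrow> u \<in> lattice_segment x y \<Longrightarrow> u \<notin> P \<Longrightarrow>
      \<exists>r\<in>Q. fst r \<in> lattice_segment x y \<and> (\<exists>j. u = ray r j)"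
proof -
  note Q = assms[unfolded pivots_def]
  show "finite Q" by (rule Q[THEN conjunct1])
  show "snd r \<noteq> (0, 0)" if "r \<in> Q"
    using Q[THEN conjunct2, THEN conjunct1] that by (rule bspec)
  show "\<exists>r\<in>Q. fst r \<in> lattice_segment x y \<and> (\<exists>j. u = ray r j)"
    if "k \<le> card (P \<inter> lattice_segment x y)" "u \<in> lattice_segment x y" "u \<notin> P"
    using that by (rule Q[THEN conjunct2, THEN conjunct2, THEN conjunct2, rule_format])
qed

text \<open>The empty set for fewer than \<open>k\<close> points makes the demand on Breaker vanish
  in the early timesteps, when \<open>b\<close> may still be too small for any guarantee.\<close>

definition pivot_set :: "point set \<Rightarrow> nat \<Rightarrow> (point \<times> point) set" where
  "pivot_set P k = (if card P < k then {} else SOME Q. pivots P k Q)"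

lemma pivots_pivot_set:
  assumes "finite P" "2 \<le> k"
  shows "pivots P k (pivot_set P k)"
proof (cases "card P < k")
  case True
  have "\<not> k \<le> card (P \<inter> A)" for A
    using True card_mono[OF assms(1), of "P \<inter> A"] by auto
  then show ?thesis using True by (simp add: pivot_set_def pivots_def)
next
  case False
  then show ?thesis using someI_ex[OF pivots_exist[OF assms]] by (simp add: pivot_set_def)
qed

definition chunking :: "'a set \<Rightarrow> nat \<Rightarrow> (nat \<Rightarrow> 'a set) \<Rightarrow> bool" where
  "chunking Q L c \<longleftrightarrow> (\<forall>q\<in>Q. \<exists>r<L. q \<in> c r) \<and> (\<forall>r. c r \<subseteq> Q \<and> card (c r) \<le> card Q div L + 1)"

definition chunk :: "'a set \<Rightarrow> nat \<Rightarrow> nat \<Rightarrow> 'a set" where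
  "chunk Q L = (SOME c. chunking Q L c)"

lemma chunking_chunk:
  assumes "finite Q" "0 < L"
  shows "chunking Q L (chunk Q L)"
proof -
  obtain f where f: "bij_betw f Q {0..<card Q}" using ex_bij_betw_finite_nat[OF assms(1)] by blast
  define w where "w = card Q div L + 1"
  have w: "0 < w" "card Q \<le> L * w"
    using assms(2) dividend_less_div_times[of L "card Q"] by (auto simp: w_def algebra_simps)
  have "chunking Q L (\<lambda>r. {q \<in> Q. f q div w = r})"
    unfolding chunking_def
  proof (intro conjI ballI allI)
    fix q assume q: "q \<in> Q"
    then have "f q < card Q" using bij_betwE[OF f] by auto
    then have "f q < L * w" using w by linarith
    then have "f q div w < L" by (simp add: less_mult_imp_div_less)
    then show "\<exists>r<L. q \<in> {q \<in> Q. f q div w = r}" using q by blast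
  next
    fix r
    have "f ` {q \<in> Q. f q div w = r} \<subseteq> {r * w..<r * w + w}"
      using w(1) by (auto simp: dividend_less_div_times add.commute)
    moreover have "inj_on f {q \<in> Q. f q div w = r}" using f by (auto simp: bij_betw_def inj_on_def)
    ultimately have "card {q \<in> Q. f q div w = r} \<le> card {r * w..<r * w + w}"
      by (intro card_inj_on_le) auto
    then show "card {q \<in> Q. f q div w = r} \<le> card Q div L + 1" by (simp add: w_def)
  qed auto
  then show ?thesis unfolding chunk_def by (rule someI[where P = "chunking Q L"])
qed

text \<open>In timestep \<open>t = length Ms\<close> every level \<open>i\<close> with \<open>2 ^ i \<le> t\<close> contributes one of \<open>2 ^ i\<close> shares of the
  pivots of the last completed window of length \<open>2 ^ i\<close>. Moves are indexed from 0, so window \<open>w\<close> is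
  completed by Maker's move in timestep \<open>(w + 1) * 2 ^ i\<close> and Breaker has dealt with all its pivots
  before timestep \<open>(w + 2) * 2 ^ i\<close>.\<close>

definition tasks :: "(nat \<Rightarrow> nat) \<Rightarrow> point set list \<Rightarrow> (point \<times> point) set" where
  "tasks k Ms = (\<Union>i\<in>{i. 2 ^ i \<le> length Ms}.
     chunk (pivot_set (\<Union>r\<in>dyadic i (length Ms div 2 ^ i - 1). Ms ! r) (k i)) (2 ^ i) (length Ms mod 2 ^ i))"

text \<open>Taking the nearest free point ensures that every point of the ray that is still free
  lies behind the reply.\<close>

definition reply :: "point set \<Rightarrow> point \<times> point \<Rightarrow> point" where
  "reply C r = ray r (LEAST j. ray r j \<notin> C)"

text \<open>A strategy must be legal after every history, including those in which the wanted
  replies \<open>R\<close> are too many. Hence \<open>R \<subseteq> B\<close> is required only when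
  it is feasible, and \<open>B\<close> is filled up to the prescribed size.\<close>

definition defence :: "(nat \<Rightarrow> nat) \<Rightarrow> (nat \<Rightarrow> nat) \<Rightarrow> history \<Rightarrow> point set \<Rightarrow> point set" where
  "defence k b h M = (let R = reply (claimed h \<union> M) ` tasks k (map fst h @ [M]) in
     SOME B. finite B \<and> card B = b (Suc (length h)) \<and> B \<inter> (claimed h \<union> M) = {} \<and>
       (finite R \<and> R \<inter> (claimed h \<union> M) = {} \<and> card R \<le> b (Suc (length h)) \<longrightarrow> R \<subseteq> B))"

lemma infinite_points: "infinite (UNIV :: point set)"
  by (simp add: finite_prod)

lemma extend_avoiding:
  fixes C R :: "point set"
  assumes "finite C"
  shows "\<exists>B. finite B \<and> card B = n \<and> B \<inter> C = {} \<and>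
    (finite R \<and> R \<inter> C = {} \<and> card R \<le> n \<longrightarrow> R \<subseteq> B)"
proof (cases "finite R \<and> R \<inter> C = {} \<and> card R \<le> n")
  case True
  have "infinite (UNIV - (C \<union> R))" using assms True infinite_points by (simp add: Diff_infinite_finite)
  then obtain D where D: "finite D" "card D = n - card R" "D \<subseteq> UNIV - (C \<union> R)"
    using infinite_arbitrarily_large by blast
  then have "card (R \<union> D) = n" using True by (subst card_Un_disjoint) auto
  then show ?thesis using True D by (intro exI[of _ "R \<union> D"]) auto
next
  case False
  have "infinite (UNIV - C)" using assms infinite_points by (simp add: Diff_infinite_finite)
  then obtain D where D: "finite D" "card D = n" "D \<subseteq> UNIV - C"
    using infinite_arbitrarily_large by blast
  then show ?thesis using False by (intro exI[of _ D]) blast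
qed

lemma defence_props:
  fixes k b :: "nat \<Rightarrow> nat" and h :: history and M :: "point set"
  assumes "finite (claimed h)" "finite M"
  defines "R \<equiv> reply (claimed h \<union> M) ` tasks k (map fst h @ [M])"
  shows "finite (defence k b h M) \<and> card (defence k b h M) = b (Suc (length h)) \<and>
    defence k b h M \<inter> (claimed h \<union> M) = {} \<and>
    (finite R \<and> R \<inter> (claimed h \<union> M) = {} \<and> card R \<le> b (Suc (length h)) \<longrightarrow> R \<subseteq> defence k b h M)"
proof -
  have "finite (claimed h \<union> M)" using assms by simp
  from someI_ex[OF extend_avoiding[OF this, of "b (Suc (length h))" R]]
  show ?thesis unfolding defence_def Let_def R_def by blast
qed

lemma breaker_strategy_defence: "breaker_strategy b (defence k b)"
  unfolding breaker_strategy_def using defence_props by blast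

lemma reply_notin:
  assumes "finite C" "snd r \<noteq> (0, 0)"
  shows "reply C r \<notin> C"
proof -
  have "\<exists>j. ray r j \<notin> C"
  proof (rule ccontr)
    assume "\<nexists>j. ray r j \<notin> C"
    then have "range (ray r) \<subseteq> C" by auto
    then have "finite (range (ray r))" using assms(1) finite_subset by blast
    then show False using range_inj_infinite[OF inj_ray[OF assms(2)]] by simp
  qed
  then show ?thesis unfolding reply_def by (rule LeastI_ex)
qed

text \<open>A bound for the number of points that level \<open>i\<close> asks Breaker to claim in timestep \<open>t\<close>: the bound
  of \<^const>\<open>pivots\<close> for a window of at most \<open>2 ^ i * m t\<close> points, spread over \<open>2 ^ i\<close> timesteps.\<close>

definition demand :: "(nat \<Rightarrow> nat) \<Rightarrow> (nat \<Rightarrow> nat) \<Rightarrow> nat \<Rightarrow> nat \<Rightarrow> real" where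
  "demand m k t i = (if 2 ^ i * m t < k i then 0 else
     (64 * real (2 ^ i * m t) / real (k i) + 8192 * real (2 ^ i * m t) ^ 2 / real (k i) ^ 3) / 2 ^ i + 1)"

lemma demand_nonneg: "0 \<le> demand m k t i"
  by (simp add: demand_def)

lemma card_chunk_le_demand:
  assumes "finite P" "2 \<le> k i" "card P \<le> 2 ^ i * m t"
  shows "real (card (chunk (pivot_set P (k i)) (2 ^ i) r)) \<le> demand m k t i"
proof -
  let ?Q = "pivot_set P (k i)"
  have piv: "pivots P (k i) ?Q" using assms by (intro pivots_pivot_set)
  then have fin: "finite ?Q" by (simp add: pivots_def)
  have ch: "chunking ?Q (2 ^ i) (chunk ?Q (2 ^ i))" using fin by (intro chunking_chunk) auto
  show ?thesis
  proof (cases "2 ^ i * m t < k i")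
    case True
    then have "?Q = {}" using assms by (simp add: pivot_set_def)
    then show ?thesis using ch demand_nonneg[of m k t i] by (auto simp: chunking_def)
  next
    case False
    have "card (chunk ?Q (2 ^ i) r) \<le> card ?Q div 2 ^ i + 1" using ch by (simp add: chunking_def)
    then have "real (card (chunk ?Q (2 ^ i) r)) \<le> real (card ?Q div 2 ^ i) + 1" by linarith
    also have "real (card ?Q div 2 ^ i) \<le> real (card ?Q) / 2 ^ i"
      using of_nat_div_le_of_nat[of "card ?Q" "2 ^ i"] by simp
    also have "real (card ?Q) \<le> 64 * real (card P) / real (k i) + 8192 * real (card P) ^ 2 / real (k i) ^ 3"
      using piv by (simp add: pivots_def)
    also have "\<dots> \<le> 64 * real (2 ^ i * m t) / real (k i) + 8192 * real (2 ^ i * m t) ^ 2 / real (k i) ^ 3"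
      using of_nat_mono[OF assms(3), where 'a = real]
      by (intro add_mono divide_right_mono mult_left_mono power_mono) auto
    finally show ?thesis using False by (simp add: demand_def divide_right_mono)
  qed
qed

text \<open>When Maker first wins, the segment contains a point of his current move. All his earlier
  moves lie in recent windows, and blocking leaves the segment fewer than \<open>k i\<close> points
  of each such window of level \<open>i\<close>.\<close>

lemma breaker_defends:
  fixes m b k :: "nat \<Rightarrow> nat"
  assumes mono: "mono m" and k: "\<And>i. 2 \<le> k i"
    and budget: "\<And>t. 1 \<le> t \<Longrightarrow> t \<le> T \<Longrightarrow> (\<Sum>i | 2 ^ i \<le> t. demand m k t i) \<le> b t"
    and n: "m T + (\<Sum>i | 2 ^ i \<le> T. 2 * k i) < n"
  shows "\<not> maker_guarantees m b n T"
proof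
  assume "maker_guarantees m b n T"
  then obtain \<sigma> where \<sigma>: "maker_strategy m \<sigma>" and wins: "\<And>\<beta>. breaker_strategy b \<beta> \<Longrightarrow>
      \<exists>s<T. \<exists>S. winning_segment n (maker_points (play \<sigma> \<beta> (Suc s))) (breaker_points (play \<sigma> \<beta> s)) S"
    unfolding maker_guarantees_def by blast
  define \<beta> where "\<beta> = defence k b"
  have \<beta>: "breaker_strategy b \<beta>" unfolding \<beta>_def by (rule breaker_strategy_defence)
  \<comment> \<open>The index \<open>s\<close> counts from 0: \<open>h s\<close> is the position
    before timestep \<open>Suc s\<close>, and \<open>mv s\<close> and \<open>bv s\<close> are the
    moves in that timestep.\<close>
  define h where "h = play \<sigma> \<beta>"
  define mv where "mv s = \<sigma> (h s)" for s
  define bv where "bv s = \<beta> (h s) (mv s)" for s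
  define C where "C s = claimed (h s) \<union> mv s" for s
  define W where "W i w = (\<Union>r\<in>dyadic i w. mv r)" for i w
  have fin: "finite (claimed (h s))" for s unfolding h_def using \<sigma> \<beta> by (rule finite_claimed_play)
  have mv: "finite (mv s)" "card (mv s) = m (Suc s)" "mv s \<inter> claimed (h s) = {}" for s
    using \<sigma> fin[of s] by (auto simp: maker_strategy_def mv_def h_def)
  have maker: "maker_points (h s) = (\<Union>r<s. mv r)" and breaker: "breaker_points (h s) = (\<Union>r<s. bv r)" for s
    unfolding h_def mv_def bv_def by (rule maker_points_play breaker_points_play)+
  have Csub: "C s' \<subseteq> claimed (h s)" if "s' < s" for s s'
  proof -
    have "claimed (h s') \<subseteq> claimed (h s)" unfolding h_def using that by (intro claimed_play_mono) simp
    moreover have "mv s' \<subseteq> maker_points (h s)" unfolding maker using that by blast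
    ultimately show ?thesis unfolding C_def claimed_def by blast
  qed
  have finW: "finite (W i w)" for i w using mv by (simp add: W_def dyadic_def)
  have cardW: "card (W i w) \<le> 2 ^ i * m t" if "(w + 1) * 2 ^ i \<le> t" for i w t
  proof -
    have "card (W i w) \<le> (\<Sum>r\<in>dyadic i w. card (mv r))"
      unfolding W_def by (rule card_UN_le) (simp add: dyadic_def)
    also have "\<dots> \<le> (\<Sum>r\<in>dyadic i w. m t)"
    proof (rule sum_mono)
      fix r assume "r \<in> dyadic i w"
      then have "Suc r \<le> t" using that by (simp add: dyadic_def)
      then show "card (mv r) \<le> m t" unfolding mv by (rule monoD[OF mono])
    qed
    also have "\<dots> = 2 ^ i * m t" by (simp add: dyadic_def)
    finally show ?thesis .
  qed
  define Ms where "Ms s = map fst (h s) @ [mv s]" for s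
  have Ms: "Ms s = map mv [0..<Suc s]" for s
    unfolding Ms_def h_def map_fst_play by (simp add: mv_def h_def)
  have tasks: "tasks k (Ms s) = (\<Union>i\<in>{i. 2 ^ i \<le> Suc s}.
     chunk (pivot_set (W i (Suc s div 2 ^ i - 1)) (k i)) (2 ^ i) (Suc s mod 2 ^ i))" for s
  proof -
    have "(\<Union>r\<in>dyadic i (Suc s div 2 ^ i - 1). Ms s ! r) = W i (Suc s div 2 ^ i - 1)"
      if "2 ^ i \<le> Suc s" for i
      unfolding W_def
    proof (intro SUP_cong refl)
      fix r assume r: "r \<in> dyadic i (Suc s div 2 ^ i - 1)"
      have "1 \<le> Suc s div 2 ^ i" using that by (simp add: Suc_leI div_greater_zero_iff)
      then have "r < Suc s div 2 ^ i * 2 ^ i" using r by (simp add: dyadic_def)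
      also have "\<dots> \<le> Suc s" by (rule div_times_less_eq_dividend)
      finally show "Ms s ! r = mv r" unfolding Ms by (simp only: nth_map_upt) simp
    qed
    then show ?thesis unfolding tasks_def by (simp add: Ms)
  qed
  have played: "reply (C s) ` tasks k (Ms s) \<subseteq> bv s" if s: "s < T" for s
  proof -
    have win: "(Suc s div 2 ^ i - 1 + 1) * 2 ^ i \<le> Suc s" if "2 ^ i \<le> Suc s" for i
    proof -
      have "1 \<le> Suc s div 2 ^ i" using that by (simp add: Suc_leI div_greater_zero_iff)
      then show ?thesis by (simp add: div_times_less_eq_dividend)
    qed
    have piv: "pivots (W i w) (k i) (pivot_set (W i w) (k i))" for i w
      by (intro pivots_pivot_set finW k)
    have ch: "chunk (pivot_set (W i w) (k i)) (2 ^ i) r \<subseteq> pivot_set (W i w) (k i)" for i w r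
      using chunking_chunk[of "pivot_set (W i w) (k i)" "2 ^ i"] piv
      by (auto simp: pivots_def chunking_def)
    have finch: "finite (chunk (pivot_set (W i w) (k i)) (2 ^ i) r)" for i w r
      by (rule finite_subset[OF ch pivots_finite[OF piv]])
    have fint: "finite (tasks k (Ms s))"
      unfolding tasks using finch finite_levels by blast
    have "card (tasks k (Ms s)) \<le> (\<Sum>i | 2 ^ i \<le> Suc s.
        card (chunk (pivot_set (W i (Suc s div 2 ^ i - 1)) (k i)) (2 ^ i) (Suc s mod 2 ^ i)))"
      unfolding tasks by (rule card_UN_le[OF finite_levels])
    then have "real (card (tasks k (Ms s))) \<le> (\<Sum>i | 2 ^ i \<le> Suc s.
        real (card (chunk (pivot_set (W i (Suc s div 2 ^ i - 1)) (k i)) (2 ^ i) (Suc s mod 2 ^ i))))"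
      unfolding of_nat_sum[symmetric] by (rule of_nat_mono)
    also have "\<dots> \<le> (\<Sum>i | 2 ^ i \<le> Suc s. demand m k (Suc s) i)"
      by (intro sum_mono card_chunk_le_demand finW k cardW win) simp
    also have "\<dots> \<le> b (Suc s)" using budget[of "Suc s"] s by simp
    finally have "card (tasks k (Ms s)) \<le> b (Suc s)" by simp
    then have "card (reply (C s) ` tasks k (Ms s)) \<le> b (Suc s)"
      using card_image_le[OF fint, of "reply (C s)"] by linarith
    moreover have "reply (C s) ` tasks k (Ms s) \<inter> C s = {}"
    proof -
      have "reply (C s) r \<notin> C s" if "r \<in> tasks k (Ms s)" for r
      proof (rule reply_notin)
        show "finite (C s)" using fin mv by (simp add: C_def)
        obtain i w where "r \<in> pivot_set (W i w) (k i)" using \<open>r \<in> _\<close> ch unfolding tasks by blast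
        then show "snd r \<noteq> (0, 0)" by (rule pivots_direction[OF piv])
      qed
      then show ?thesis by blast
    qed
    ultimately show ?thesis
      using defence_props[OF fin mv(1), of k b s s] fint
      unfolding bv_def \<beta>_def C_def Ms_def h_def length_play by blast
  qed
  \<comment> \<open>Otherwise Breaker has answered the pivot whose ray contains \<open>u\<close> by a point between that pivot and \<open>u\<close>.\<close>
  have sparse: "card (W i w \<inter> lattice_segment x y) < k i"
    if H: "(w + 2) * 2 ^ i \<le> Suc s" "s < T" "u \<in> mv s" "u \<in> lattice_segment x y"
      "breaker_points (h s) \<inter> lattice_segment x y = {}" for i w s u x y
  proof (rule ccontr)
    assume "\<not> card (W i w \<inter> lattice_segment x y) < k i"
    then have big: "k i \<le> card (W i w \<inter> lattice_segment x y)" by simp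
    let ?Q = "pivot_set (W i w) (k i)"
    have piv: "pivots (W i w) (k i) ?Q" by (intro pivots_pivot_set finW k)
    have "W i w \<subseteq> maker_points (h s)"
    proof -
      have "(1::nat) \<le> 2 ^ i" by simp
      moreover have "(w + 2) * 2 ^ i = (w + 1) * 2 ^ i + 2 ^ i" by (simp add: algebra_simps)
      ultimately have "(w + 1) * 2 ^ i \<le> s" using H(1) by linarith
      then have "dyadic i w \<subseteq> {..<s}" by (auto simp: dyadic_def)
      then show ?thesis unfolding maker W_def by blast
    qed
    then have "u \<notin> W i w" using H(3) mv(3)[of s] by (auto simp: claimed_def)
    then obtain r j where r: "r \<in> ?Q" "fst r \<in> lattice_segment x y" "u = ray r j"
      using pivots_hit[OF piv big H(4)] by blast
    obtain c where c: "c < 2 ^ i" "r \<in> chunk ?Q (2 ^ i) c"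
      using chunking_chunk[of ?Q "2 ^ i"] piv r(1) by (auto simp: pivots_def chunking_def)
    \<comment> \<open>Share \<open>c\<close> of window \<open>w\<close> is due in timestep
      \<open>(w + 1) * 2 ^ i + c\<close>; subtracting 1 gives the index of the move.\<close>
    define s' where "s' = (w + 1) * 2 ^ i + c - 1"
    have Suc_s': "Suc s' = (w + 1) * 2 ^ i + c" by (simp add: s'_def)
    have "Suc s' < (w + 2) * 2 ^ i" unfolding Suc_s' using c(1) by (simp add: algebra_simps)
    then have s': "s' < s" using H(1) by linarith
    have "Suc s' div 2 ^ i = w + 1" unfolding Suc_s' using c(1) by (subst div_mult_self3) auto
    moreover have "Suc s' mod 2 ^ i = c" unfolding Suc_s' using c(1) by (subst mod_mult_self3) auto
    moreover have "2 ^ i \<le> Suc s'" unfolding Suc_s' by (simp add: algebra_simps)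
    ultimately have "r \<in> tasks k (Ms s')" unfolding tasks using c(2) by force
    then have "reply (C s') r \<in> bv s'" using played[of s'] s' H(2) by auto
    then have "reply (C s') r \<in> breaker_points (h s)" unfolding breaker using s' by blast
    moreover have "u \<notin> C s'" using Csub[OF s'] mv(3)[of s] H(3) by blast
    then have "(LEAST j. ray r j \<notin> C s') \<le> j" unfolding r(3) by (rule Least_le)
    then have "reply (C s') r \<in> lattice_segment x y"
      unfolding reply_def using ray_in_segment[OF r(2)] H(4) r(3) by blast
    ultimately show False using H(5) by blast
  qed
  \<comment> \<open>The least such \<open>s\<close> is taken. If the segment avoided the current
    move, it would have been winning one timestep earlier, when Breaker had no more points than
    now.\<close>
  define wins_at where "wins_at s \<longleftrightarrow> s < T \<and> (\<exists>S. winning_segment n (maker_points (h (Suc s))) (breaker_points (h s)) S)" for s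
  have "\<exists>s. wins_at s" using wins[OF \<beta>] unfolding wins_at_def h_def by blast
  then obtain s where s: "wins_at s" "\<And>s'. s' < s \<Longrightarrow> \<not> wins_at s'"
    by (metis LeastI_ex not_less_Least)
  then obtain S where sT: "s < T" and S: "winning_segment n (maker_points (h (Suc s))) (breaker_points (h s)) S"
    by (auto simp: wins_at_def)
  obtain x y where xy: "x \<in> S" "S \<subseteq> lattice_segment x y" "breaker_points (h s) \<inter> lattice_segment x y = {}"
    using S unfolding winning_segment_def lattice_segment_def by blast
  have Sm: "S \<subseteq> maker_points (h s) \<union> mv s" "finite S" "card S = n"
    using S maker_points_Suc[of \<sigma> \<beta> s] by (auto simp: winning_segment_def h_def mv_def)
  have "S \<inter> mv s \<noteq> {}"
  proof
    assume "S \<inter> mv s = {}"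
    then have sub: "S \<subseteq> maker_points (h s)" using Sm by blast
    then have "s \<noteq> 0" using xy(1) by (auto simp: maker)
    then obtain s' where s': "s = Suc s'" by (cases s) auto
    have "breaker_points (h s') \<subseteq> breaker_points (h s)" unfolding breaker s' lessThan_Suc by blast
    then have "winning_segment n (maker_points (h (Suc s'))) (breaker_points (h s')) S"
      using S sub unfolding s' winning_segment_def by blast
    then show False using s(2)[of s'] sT s' by (auto simp: wins_at_def)
  qed
  then obtain u where u: "u \<in> mv s" "u \<in> lattice_segment x y" using xy by blast
  let ?A = "\<lambda>i. \<Union>w\<in>recent_windows (Suc s) i. W i w \<inter> lattice_segment x y"
  have "S \<subseteq> mv s \<union> (\<Union>i\<in>{i. 2 ^ i \<le> Suc s}. ?A i)"
  proof
    fix p assume p: "p \<in> S"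
    show "p \<in> mv s \<union> (\<Union>i\<in>{i. 2 ^ i \<le> Suc s}. ?A i)"
    proof (cases "p \<in> mv s")
      case False
      then obtain r where r: "r < s" "p \<in> mv r" using p Sm by (auto simp: maker)
      then obtain i w where "2 ^ i \<le> Suc s" "w \<in> recent_windows (Suc s) i" "r \<in> dyadic i w"
        using dyadic_cover[of r "Suc s"] by auto
      then show ?thesis using r p xy(2) unfolding W_def by blast
    qed simp
  qed
  then have "card S \<le> card (mv s \<union> (\<Union>i\<in>{i. 2 ^ i \<le> Suc s}. ?A i))"
    by (rule card_mono[rotated]) (use mv finW finite_levels finite_recent_windows in auto)
  also have "\<dots> \<le> card (mv s) + card (\<Union>i\<in>{i. 2 ^ i \<le> Suc s}. ?A i)" by (rule card_Un_le)
  also have "card (\<Union>i\<in>{i. 2 ^ i \<le> Suc s}. ?A i) \<le> (\<Sum>i | 2 ^ i \<le> Suc s. card (?A i))"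
    by (rule card_UN_le[OF finite_levels])
  also have "\<dots> \<le> (\<Sum>i | 2 ^ i \<le> Suc s. 2 * k i)"
  proof (rule sum_mono)
    fix i
    have "card (?A i) \<le> (\<Sum>w\<in>recent_windows (Suc s) i. card (W i w \<inter> lattice_segment x y))"
      by (rule card_UN_le[OF finite_recent_windows])
    also have "\<dots> \<le> (\<Sum>w\<in>recent_windows (Suc s) i. k i)"
      by (intro sum_mono less_imp_le sparse[OF recent_windows_le sT u xy(3)])
    also have "\<dots> \<le> 2 * k i" using card_recent_windows[of "Suc s" i] by simp
    finally show "card (?A i) \<le> 2 * k i" .
  qed
  also have "\<dots> \<le> (\<Sum>i | 2 ^ i \<le> T. 2 * k i)"
    by (rule sum_mono2[OF finite_levels]) (use sT in auto)
  also have "card (mv s) \<le> m T" using mv(2) mono sT by (simp add: monoD)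
  finally show False using n Sm(3) by simp
qed

section \<open>The winning time\<close>

lemma levels_eq:
  assumes "1 \<le> (t::nat)"
  obtains I where "{i. 2 ^ i \<le> t} = {..I}" "2 ^ I \<le> t"
proof -
  have ne: "{i. 2 ^ i \<le> t} \<noteq> {}" using assms by (auto intro: exI[of _ 0])
  define I where "I = Max {i. 2 ^ i \<le> t}"
  have I: "2 ^ I \<le> t" using Max_in[OF finite_levels ne] by (simp add: I_def)
  have "{i. 2 ^ i \<le> t} = {..I}"
  proof
    show "{i. 2 ^ i \<le> t} \<subseteq> {..I}" using Max_ge[OF finite_levels] by (auto simp: I_def)
    show "{..I} \<subseteq> {i. 2 ^ i \<le> t}"
    proof clarsimp
      fix i assume "i \<le> I"
      then have "(2::nat) ^ i \<le> 2 ^ I" by (rule power_increasing) simp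
      then show "2 ^ i \<le> t" using I by linarith
    qed
  qed
  then show ?thesis using I that by blast
qed

lemma sum_geometric_le:
  fixes x :: real
  assumes "0 < x" "x < 1"
  shows "(\<Sum>i\<le>I. x ^ i) \<le> 1 / (1 - x)"
proof -
  have "(\<Sum>i\<le>I. x ^ i) = (1 - x ^ Suc I) / (1 - x)"
    using sum_gp0[of x I] assms by simp
  also have "\<dots> \<le> 1 / (1 - x)" using assms by (intro divide_right_mono) auto
  finally show ?thesis .
qed

text \<open>An increasing geometric sum is governed by its last term, here
  \<open>(2 ^ I) powr \<gamma>\<close>.\<close>

lemma sum_geometric_levels_le:
  fixes \<gamma> :: real
  assumes "0 < \<gamma>" "2 ^ I \<le> (t::nat)"
  shows "(\<Sum>i\<le>I. (2 powr \<gamma>) ^ i) \<le> 1 / (1 - 2 powr - \<gamma>) * real t powr \<gamma>"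
proof -
  let ?x = "2 powr \<gamma> :: real"
  have x: "1 < ?x" using assms by simp
  have "(\<Sum>i\<le>I. ?x ^ i) = (?x ^ Suc I - 1) / (?x - 1)"
    using sum_gp0[of ?x I] x assms(1) by (simp add: field_simps)
  also have "\<dots> \<le> ?x ^ Suc I / (?x - 1)" using x by (intro divide_right_mono) auto
  also have "\<dots> = 1 / (1 - 2 powr - \<gamma>) * ?x ^ I"
    using x by (simp add: powr_minus field_simps)
  also have "\<dots> \<le> 1 / (1 - 2 powr - \<gamma>) * real t powr \<gamma>"
  proof (rule mult_left_mono)
    have "?x ^ I = (2 ^ I) powr \<gamma>"
      by (simp add: powr_powr powr_realpow[symmetric] mult.commute)
    also have "\<dots> \<le> real t powr \<gamma>"
      using assms of_nat_mono[OF assms(2), where 'a = real] by (intro powr_mono2) auto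
    finally show "?x ^ I \<le> real t powr \<gamma>" .
    have "2 powr - \<gamma> < (2 powr 0 :: real)" using assms by (intro powr_less_mono) auto
    then show "0 \<le> 1 / (1 - 2 powr - \<gamma> :: real)" by simp
  qed
  finally show ?thesis .
qed

text \<open>Insert a window of at most \<open>2 ^ i * 2 * t powr \<alpha>\<close> points into the
  demand. The first summand decays with the level. The second grows, and at the top level, where
  \<open>2 ^ i\<close> is about \<open>t\<close>, it has order \<open>t powr (1 - \<alpha>)\<close>,
  the exponent of Breaker's budget.\<close>

lemma demand_le:
  fixes \<alpha> \<eta> c :: real
  assumes t: "1 \<le> t" and mt: "real (m t) \<le> 2 * real t powr \<alpha>" and c: "0 < c"
    and k: "c * (2 powr \<eta>) ^ i * real t powr (\<alpha> - \<eta>) \<le> k i"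
  shows "demand m k t i \<le> 128 / c * real t powr \<eta> * (2 powr - \<eta>) ^ i +
    32768 / c ^ 3 * real t powr (3 * \<eta> - \<alpha>) * (2 powr (1 - 3 * \<eta>)) ^ i + 1"
proof -
  define x where "x = (2 powr \<eta> :: real) ^ i"
  define y where "y = (2::real) ^ i"
  define a where "a = real t powr \<alpha>"
  define e where "e = real t powr \<eta>"
  define \<kappa> where "\<kappa> = c * x * (a / e)"
  have pos: "0 < x" "0 < y" "0 < a" "0 < e" using t by (auto simp: x_def y_def a_def e_def)
  have \<kappa>: "0 < \<kappa>" "\<kappa> \<le> k i" using k c pos by (auto simp: \<kappa>_def x_def a_def e_def powr_diff)
  have N: "real (2 ^ i * m t) \<le> y * (2 * a)" using mt pos by (simp add: y_def a_def)
  have 1: "64 * real (2 ^ i * m t) / real (k i) \<le> 64 * (y * (2 * a)) / \<kappa>"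
    using N \<kappa> pos by (intro frac_le mult_left_mono) auto
  have 2: "8192 * real (2 ^ i * m t) ^ 2 / real (k i) ^ 3 \<le> 8192 * (y * (2 * a)) ^ 2 / \<kappa> ^ 3"
    using N \<kappa> pos by (intro frac_le mult_left_mono power_mono) auto
  have e3: "real t powr (3 * \<eta> - \<alpha>) = e ^ 3 / a"
    using t by (simp add: powr_diff e_def a_def powr_realpow[symmetric] powr_powr mult.commute)
  have x3: "(2 powr (1 - 3 * \<eta>)) ^ i = y / x ^ 3"
    by (simp add: powr_diff x_def y_def power_divide power_mult[symmetric] powr_realpow[symmetric] powr_powr mult_ac)
  have x1: "(2 powr - \<eta>) ^ i = 1 / x" by (simp add: powr_minus x_def power_inverse divide_inverse)
  have "demand m k t i \<le> (64 * real (2 ^ i * m t) / real (k i) + 8192 * real (2 ^ i * m t) ^ 2 / real (k i) ^ 3) / y + 1"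
    by (simp add: demand_def y_def)
  also have "\<dots> \<le> (64 * (y * (2 * a)) / \<kappa> + 8192 * (y * (2 * a)) ^ 2 / \<kappa> ^ 3) / y + 1"
    using 1 2 pos by (intro add_mono divide_right_mono) auto
  also have "\<dots> = 128 / c * e * (1 / x) + 32768 / c ^ 3 * (e ^ 3 / a) * (y / x ^ 3) + 1"
    using pos c by (simp add: \<kappa>_def field_simps power_numeral_reduce)
  finally show ?thesis unfolding e3 x3 x1 e_def .
qed

text \<open>Only finitely many points are claimed, so some horizontal row is untouched, and Maker
  fills it within one move before Breaker can reply.\<close>

lemma maker_guarantees_row:
  assumes n: "1 \<le> n" and t: "1 \<le> t" "n \<le> m t"
  shows "maker_guarantees m b n t"
proof -
  define y0 where "y0 h = (SOME y::int. y \<notin> snd ` claimed h)" for h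
  have y0: "y0 h \<notin> snd ` claimed h" if "finite (claimed h)" for h
    unfolding y0_def by (rule someI_ex, rule ex_new_if_finite) (use that in \<open>auto simp: infinite_UNIV_int\<close>)
  define \<sigma> where "\<sigma> h = (\<lambda>i. (int i, y0 h)) ` {..<m (Suc (length h))}" for h
  have \<sigma>: "maker_strategy m \<sigma>"
    unfolding maker_strategy_def
  proof (intro allI impI conjI)
    fix h assume fin: "finite (claimed h)"
    show "finite (\<sigma> h)" by (simp add: \<sigma>_def)
    show "card (\<sigma> h) = m (Suc (length h))" unfolding \<sigma>_def by (subst card_image) (auto simp: inj_on_def)
    show "\<sigma> h \<inter> claimed h = {}" using y0[OF fin] by (force simp: \<sigma>_def)
  qed
  show ?thesis
    unfolding maker_guarantees_def
  proof (intro exI[of _ \<sigma>] conjI \<sigma> allI impI)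
    fix \<beta> assume \<beta>: "breaker_strategy b \<beta>"
    define s where "s = t - 1"
    define h where "h = play \<sigma> \<beta> s"
    define S where "S = (\<lambda>i. (int i, y0 h)) ` {..<n}"
    have fin: "finite (claimed h)" unfolding h_def using \<sigma> \<beta> by (rule finite_claimed_play)
    have "S \<subseteq> \<sigma> h" using t by (auto simp: S_def \<sigma>_def h_def s_def)
    then have 1: "S \<subseteq> maker_points (play \<sigma> \<beta> (Suc s))" unfolding maker_points_Suc h_def by blast
    have 2: "card S = n" unfolding S_def by (subst card_image) (auto simp: inj_on_def)
    have 3: "collinear (to_plane ` S)" unfolding collinear_def
      by (intro exI[of _ "(1, 0)"]) (auto simp: S_def to_plane_def)
    let ?x = "(0, y0 h)" and ?y = "(int (n - 1), y0 h)"
    have xy: "?x \<in> S" "?y \<in> S" using n by (auto simp: S_def image_iff intro: bexI[of _ 0] bexI[of _ "n - 1"])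
    have 4: "p \<in> lattice_segment ?x ?y" if p: "p \<in> S" for p
    proof -
      obtain i where i: "i < n" "p = (int i, y0 h)" using p by (auto simp: S_def)
      show ?thesis
      proof (cases "n = 1")
        case True
        then show ?thesis using i by (auto simp: mem_lattice_segment intro!: exI[of _ 0])
      next
        case False
        define u where "u = real i / real (n - 1)"
        have "0 < real (n - 1)" "real i \<le> real (n - 1)" using n i False by auto
        then have "0 \<le> u" "u \<le> 1" "real i = u * real (n - 1)" by (auto simp: u_def)
        then show ?thesis using i unfolding mem_lattice_segment
          by (intro exI[of _ u]) (simp add: algebra_simps)
      qed
    qed
    have 5: "p \<notin> lattice_segment ?x ?y" if p: "p \<in> breaker_points h" for p
    proof
      assume "p \<in> lattice_segment ?x ?y"
      then have "real_of_int (snd p) = y0 h" unfolding mem_lattice_segment by (auto simp: algebra_simps)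
      then show False using y0[OF fin] p by (force simp: claimed_def)
    qed
    have "winning_segment n (maker_points (play \<sigma> \<beta> (Suc s))) (breaker_points h) S"
      unfolding winning_segment_def
    proof (intro conjI)
      show "\<exists>x\<in>S. \<exists>y\<in>S. (\<forall>p\<in>S. between (to_plane x, to_plane y) (to_plane p)) \<and>
          (\<forall>p\<in>breaker_points h. \<not> between (to_plane x, to_plane y) (to_plane p))"
        using xy 4 5 unfolding lattice_segment_def by blast
    qed (use 1 2 3 in \<open>auto simp: S_def\<close>)
    then show "\<exists>s<t. \<exists>S. winning_segment n (maker_points (play \<sigma> \<beta> (Suc s))) (breaker_points (play \<sigma> \<beta> s)) S"
      using t by (intro exI[of _ s]) (auto simp: h_def s_def)
  qed
qed

text \<open>Keeps \<open>m\<close> from jumping past \<open>n\<close> by more than a constant at the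
  first timestep with \<open>n \<le> m t\<close>.\<close>

lemma powr_Suc_le:
  fixes \<alpha> :: real
  assumes "\<alpha> \<le> 1" "1 \<le> a"
  shows "(a + 1) powr \<alpha> \<le> a powr \<alpha> + 1"
proof -
  have "a * (1 + 1 / a) = a + 1" using assms by (simp add: distrib_left)
  then have "(a + 1) powr \<alpha> = (a * (1 + 1 / a)) powr \<alpha>" by simp
  also have "\<dots> = a powr \<alpha> * (1 + 1 / a) powr \<alpha>" using assms by (intro powr_mult)
  also have "\<dots> \<le> a powr \<alpha> * (1 + 1 / a) powr 1"
    using assms by (intro mult_left_mono powr_mono) auto
  also have "\<dots> = a powr \<alpha> + a powr (\<alpha> - 1)"
    using assms by (simp add: powr_diff field_simps)
  also have "a powr (\<alpha> - 1) \<le> a powr 0" using assms by (intro powr_mono) auto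
  finally show ?thesis using assms by simp
qed

lemma eventually_powr_ge:
  fixes Z p :: real
  assumes "0 < p"
  shows "\<forall>\<^sub>F n in sequentially. Z \<le> real n powr p"
proof -
  have "\<forall>\<^sub>F n in sequentially. \<bar>Z\<bar> powr (1 / p) \<le> real n"
    using filterlim_real_sequentially by (simp add: filterlim_at_top)
  then show ?thesis
  proof eventually_elim
    case (elim n)
    have "Z \<le> (\<bar>Z\<bar> powr (1 / p)) powr p" using assms by (simp add: powr_powr)
    also have "\<dots> \<le> real n powr p" using elim assms by (intro powr_mono2) auto
    finally show ?case .
  qed
qed

section \<open>Bounds on the winning time\<close>

context
  fixes \<alpha> :: real and m b :: "nat \<Rightarrow> nat"
  assumes \<alpha>: "0 < \<alpha>" "\<alpha> < 1"
    and mono_m: "mono m"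
    and m: "\<And>t. 1 \<le> t \<Longrightarrow> int (m t) = \<lfloor>real t powr \<alpha>\<rfloor> \<or> int (m t) = \<lceil>real t powr \<alpha>\<rceil>"
begin

lemma m_bounds:
  assumes "1 \<le> t"
  shows "real t powr \<alpha> - 1 \<le> m t" "m t \<le> real t powr \<alpha> + 1"
  using m[OF assms] by linarith+

lemma ex_m_ge: "\<exists>t\<ge>1. n \<le> m t"
proof -
  define t where "t = nat \<lceil>(real n + 1) powr (1 / \<alpha>)\<rceil>"
  have t: "(real n + 1) powr (1 / \<alpha>) \<le> real t" unfolding t_def by linarith
  have "1 \<le> (real n + 1) powr (1 / \<alpha>)" using \<alpha> by (intro ge_one_powr_ge_zero) auto
  then have t1: "1 \<le> t" using t by linarith
  have "real n + 1 = ((real n + 1) powr (1 / \<alpha>)) powr \<alpha>" using \<alpha> by (simp add: powr_powr)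
  also have "\<dots> \<le> real t powr \<alpha>" using t \<alpha> by (intro powr_mono2) auto
  finally have "real n \<le> real (m t)" using m_bounds(1)[OF t1] by linarith
  then show ?thesis using t1 by auto
qed

text \<open>Let \<open>t\<close> be the first time with \<open>n \<le> m t\<close>. Before it,
  \<open>(t - 1) powr \<alpha> \<le> n\<close>; the step to \<open>t\<close> adds at most 1, and
  rounding adds at most 1 more.\<close>

lemma winning_time_upper:
  assumes n: "1 \<le> n"
  shows "m (winning_time m b n) \<le> n + 2"
proof -
  define t where "t = (LEAST t. 1 \<le> t \<and> n \<le> m t)"
  have t: "1 \<le> t \<and> n \<le> m t" unfolding t_def by (rule LeastI_ex) (use ex_m_ge in blast)
  have "winning_time m b n \<le> t"
    unfolding winning_time_def by (rule Least_le) (use maker_guarantees_row n t in blast)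
  then have "m (winning_time m b n) \<le> m t" by (rule monoD[OF mono_m])
  moreover have "real (m t) \<le> n + 2"
  proof (cases "t = 1")
    case True
    then show ?thesis using m_bounds(2)[of 1] by simp
  next
    case False
    then have t1: "1 \<le> t - 1" using t by linarith
    have "\<not> (1 \<le> t - 1 \<and> n \<le> m (t - 1))"
      using not_less_Least[of "t - 1" "\<lambda>t. 1 \<le> t \<and> n \<le> m t"] t unfolding t_def[symmetric] by auto
    then have "m (t - 1) < n" using t1 by simp
    then have "real (t - 1) powr \<alpha> \<le> n" using m_bounds(1)[OF t1] by linarith
    moreover have "real t = real (t - 1) + 1" using t by simp
    then have "real t powr \<alpha> \<le> real (t - 1) powr \<alpha> + 1"
      using powr_Suc_le[of \<alpha> "real (t - 1)"] \<alpha> t1 by simp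
    ultimately show ?thesis using m_bounds(2)[of t] t by linarith
  qed
  ultimately show ?thesis by linarith
qed

text \<open>A value \<open>m T\<close> below \<open>(1 - e) * n\<close> helps twice: it leaves
  \<open>e * n\<close> points of the segment to earlier moves, and it gives
  \<open>T powr \<alpha> \<le> n\<close>, so that thresholds depending only on \<open>n\<close> suit
  all timesteps up to \<open>T\<close>.\<close>

lemma maker_needs_almost_n:
  assumes b: "filterlim (\<lambda>t. real (b t) / real t powr (1 - \<alpha>)) at_top sequentially"
    and e: "0 < e"
  shows "\<forall>\<^sub>F n in sequentially. \<forall>t. maker_guarantees m b n t \<longrightarrow> (1 - e) * real n \<le> m t"
proof -
  \<comment> \<open>Small enough that \<open>\<eta> < \<alpha>\<close>, that
    \<open>1 - 3 * \<eta>\<close> is positive, and that \<open>t powr \<eta>\<close> is absorbed by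
    \<open>t powr (1 - \<alpha>)\<close>.\<close>
  define \<eta> where "\<eta> = min \<alpha> (1 - \<alpha>) / 4"
  have \<eta>: "0 < \<eta>" "4 * \<eta> \<le> \<alpha>" "4 * \<eta> \<le> 1 - \<alpha>" using \<alpha> by (auto simp: \<eta>_def)
  then have \<eta>3: "0 < 1 - 3 * \<eta>" using \<alpha> by linarith
  have q: "\<eta> / \<alpha> < 1" "0 < \<eta> / \<alpha>" using \<eta> \<alpha> by auto
  define G where "G = 1 / (1 - 2 powr - \<eta> :: real)"
  define G' where "G' = 1 / (1 - 2 powr - (1 - 3 * \<eta>) :: real)"
  have lt1: "2 powr - \<eta> < (2 powr 0 :: real)" using \<eta> by (intro powr_less_mono) auto
  then have G: "0 < G" by (simp add: G_def)
  \<comment> \<open>With this value the main part of the sum of all \<open>2 * k i\<close> is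
    \<open>2 * c * G * n\<close>, that is \<open>e / 4 * n\<close>.\<close>
  define c where "c = e / (8 * G)"
  have c: "0 < c" using e G by (simp add: c_def)
  \<comment> \<open>The coefficients of the three summands of the demand after summation over the
    levels; the \<open>+ 1\<close> of each level is bounded by
    \<open>(2 powr \<eta>) ^ i\<close>.\<close>
  define K where "K = 128 / c * G + 32768 / c ^ 3 * G' + G"
  have "\<forall>\<^sub>F t in sequentially. K \<le> real (b t) / real t powr (1 - \<alpha>)"
    using b by (simp add: filterlim_at_top)
  then obtain t0 where t0: "\<And>t. t0 \<le> t \<Longrightarrow> K \<le> real (b t) / real t powr (1 - \<alpha>)"
    by (auto simp: eventually_sequentially)
  \<comment> \<open>If \<open>t powr \<alpha> \<le> n\<close>, then \<open>\<theta> n\<close> is at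
    least \<open>t powr (\<alpha> - \<eta>)\<close>, as the demand estimate requires. At the top
    level the factor \<open>(2 powr \<eta>) ^ i\<close> is at most
    \<open>n powr (\<eta> / \<alpha>)\<close>, which brings the threshold to order
    \<open>c * n\<close>.\<close>
  define \<theta> where "\<theta> n = real n powr (1 - \<eta> / \<alpha>)" for n
  \<comment> \<open>The first condition puts every threshold above the size of any window before
    \<open>t0\<close>, so nothing is demanded there. The second absorbs the rounding of the
    \<open>k i\<close> into another \<open>e / 4 * n\<close>.\<close>
  have "\<forall>\<^sub>F n in sequentially. (2 + real (t0 * m t0)) / c \<le> \<theta> n"
    "\<forall>\<^sub>F n in sequentially. 8 * G / e \<le> \<theta> n"
    unfolding \<theta>_def using q by (intro eventually_powr_ge; simp)+
  moreover have "\<forall>\<^sub>F n in sequentially. 1 / e \<le> real n"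
    using filterlim_real_sequentially by (simp add: filterlim_at_top)
  moreover have "\<forall>\<^sub>F n in sequentially. 1 \<le> n" by (rule eventually_ge_at_top)
  ultimately show ?thesis
  proof eventually_elim
    case (elim n)
    have \<theta>: "2 + real (t0 * m t0) \<le> c * \<theta> n" using elim(1) c by (simp add: field_simps)
    \<comment> \<open>The exponent \<open>\<eta>\<close> makes both the thresholds \<open>k i\<close> and the dominating term of the demands of the
      levels grow geometrically, so that their sums are governed by the top level.\<close>
    define k where "k i = nat \<lceil>c * (2 powr \<eta>) ^ i * \<theta> n\<rceil>" for i :: nat
    have k: "c * (2 powr \<eta>) ^ i * \<theta> n \<le> k i" "k i \<le> c * (2 powr \<eta>) ^ i * \<theta> n + 1" for i
      using c by (auto simp: k_def \<theta>_def)
    have x1: "1 \<le> (2 powr \<eta> :: real) ^ i" for i using \<eta> by (intro one_le_power) (simp add: ge_one_powr_ge_zero)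
    have c\<theta>: "c * \<theta> n \<le> k i" for i
    proof -
      have "c * \<theta> n * 1 \<le> c * \<theta> n * (2 powr \<eta>) ^ i"
        using x1 c by (intro mult_left_mono) (auto simp: \<theta>_def)
      then show ?thesis using k(1)[of i] by (simp add: algebra_simps)
    qed
    have k2: "2 \<le> k i" for i
    proof -
      have "(2::real) \<le> k i" using c\<theta>[of i] \<theta> by linarith
      then show ?thesis by linarith
    qed
    show ?case
    proof (intro allI impI, rule ccontr)
      fix T assume mg: "maker_guarantees m b n T" and "\<not> (1 - e) * real n \<le> m T"
      then have mT: "m T < (1 - e) * real n" by simp
      \<comment> \<open>At \<open>T = 0\<close> no timestep is available to win in; a legal Breaker
        strategy is needed to turn this into a contradiction.\<close>
      have T1: "1 \<le> T" using mg breaker_strategy_defence[of b k]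
        by (cases T) (auto simp: maker_guarantees_def)
      have "1 \<le> e * n" using elim(3) e by (simp add: field_simps)
      then have T\<alpha>: "real T powr \<alpha> \<le> n" using mT m_bounds(1)[OF T1] by (simp add: algebra_simps)
      have T\<eta>: "real T powr \<eta> \<le> real n powr (\<eta> / \<alpha>)"
        using powr_mono2[OF _ _ T\<alpha>, of "\<eta> / \<alpha>"] q \<alpha> by (simp add: powr_powr)
      have n\<theta>: "\<theta> n * real n powr (\<eta> / \<alpha>) = n"
        using elim(4) by (simp add: \<theta>_def powr_add[symmetric])
      obtain I where I: "{i. 2 ^ i \<le> T} = {..I}" "2 ^ I \<le> T" using levels_eq[OF T1] .
      have "real (\<Sum>i | 2 ^ i \<le> T. 2 * k i) = (\<Sum>i\<le>I. 2 * real (k i))" by (simp add: I)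
      also have "\<dots> \<le> (\<Sum>i\<le>I. 2 * (c * \<theta> n + 1) * (2 powr \<eta>) ^ i)"
      proof (rule sum_mono)
        fix i show "2 * real (k i) \<le> 2 * (c * \<theta> n + 1) * (2 powr \<eta>) ^ i"
          using k(2)[of i] x1[of i] by (simp add: algebra_simps)
      qed
      also have "\<dots> = 2 * (c * \<theta> n + 1) * (\<Sum>i\<le>I. (2 powr \<eta>) ^ i)" by (simp add: sum_distrib_left)
      also have "\<dots> \<le> 2 * (c * \<theta> n + 1) * (G * real n powr (\<eta> / \<alpha>))"
      proof (rule mult_left_mono)
        show "(\<Sum>i\<le>I. (2 powr \<eta>) ^ i) \<le> G * real n powr (\<eta> / \<alpha>)"
          using sum_geometric_levels_le[OF \<eta>(1) I(2)] mult_left_mono[OF T\<eta>, of G] G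
          unfolding G_def by linarith
        show "0 \<le> 2 * (c * \<theta> n + 1)" using c by (simp add: \<theta>_def)
      qed
      also have "\<dots> = 2 * c * G * (\<theta> n * real n powr (\<eta> / \<alpha>)) + 2 * G * real n powr (\<eta> / \<alpha>)"
        by (simp add: algebra_simps)
      also have "\<dots> = e / 4 * n + 2 * G * real n powr (\<eta> / \<alpha>)"
        unfolding n\<theta> using G by (simp add: c_def)
      also have "2 * G * real n powr (\<eta> / \<alpha>) \<le> e / 4 * (\<theta> n * real n powr (\<eta> / \<alpha>))"
        using mult_right_mono[OF elim(2), of "real n powr (\<eta> / \<alpha>)"] e by (simp add: field_simps)
      finally have "real (\<Sum>i | 2 ^ i \<le> T. 2 * k i) \<le> e / 2 * n" unfolding n\<theta> by simp
      then have "real (m T + (\<Sum>i | 2 ^ i \<le> T. 2 * k i)) < (1 - e) * n + e / 2 * n" using mT by simp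
      also have "\<dots> \<le> n" using e by (simp add: algebra_simps)
      finally have total: "m T + (\<Sum>i | 2 ^ i \<le> T. 2 * k i) < n" by (simp only: of_nat_less_iff)
      have budget: "(\<Sum>i | 2 ^ i \<le> t. demand m k t i) \<le> b t" if t: "1 \<le> t" "t \<le> T" for t
      proof (cases "t < t0")
        case True
        have "demand m k t i = 0" if "2 ^ i \<le> t" for i
        proof -
          have "2 ^ i * m t \<le> t0 * m t0"
            using that True by (intro mult_mono monoD[OF mono_m]) auto
          then have "real (2 ^ i * m t) < k i"
            using c\<theta>[of i] \<theta> of_nat_mono[of "2 ^ i * m t" "t0 * m t0", where 'a = real] by linarith
          then have "2 ^ i * m t < k i" by (simp only: of_nat_less_iff)
          then show ?thesis by (simp add: demand_def)
        qed
        then show ?thesis by simp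
      next
        case False
        have mt: "real (m t) \<le> 2 * real t powr \<alpha>"
          using m_bounds(2)[OF t(1)] ge_one_powr_ge_zero[of "real t" \<alpha>] t \<alpha> by simp
        have "real t powr \<alpha> \<le> n" using powr_mono2[of \<alpha> "real t" "real T"] t \<alpha> T\<alpha> by linarith
        then have "(real t powr \<alpha>) powr (1 - \<eta> / \<alpha>) \<le> \<theta> n"
          unfolding \<theta>_def using q by (intro powr_mono2) auto
        also have "(real t powr \<alpha>) powr (1 - \<eta> / \<alpha>) = real t powr (\<alpha> - \<eta>)"
          using \<alpha> by (simp add: powr_powr algebra_simps)
        finally have t\<theta>: "real t powr (\<alpha> - \<eta>) \<le> \<theta> n" .
        have kt: "c * (2 powr \<eta>) ^ i * real t powr (\<alpha> - \<eta>) \<le> k i" for i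
          by (rule order.trans[OF mult_left_mono[OF t\<theta>] k(1)]) (use c in simp)
        obtain I where I: "{i. 2 ^ i \<le> t} = {..I}" "2 ^ I \<le> t" using levels_eq[OF t(1)] .
        let ?u = "128 / c * real t powr \<eta>" and ?v = "32768 / c ^ 3 * real t powr (3 * \<eta> - \<alpha>)"
        have "(\<Sum>i | 2 ^ i \<le> t. demand m k t i) \<le>
            (\<Sum>i\<le>I. ?u * (2 powr - \<eta>) ^ i + ?v * (2 powr (1 - 3 * \<eta>)) ^ i + (2 powr \<eta>) ^ i)"
          unfolding I
        proof (rule sum_mono)
          fix i
          show "demand m k t i \<le> ?u * (2 powr - \<eta>) ^ i + ?v * (2 powr (1 - 3 * \<eta>)) ^ i + (2 powr \<eta>) ^ i"
            using demand_le[where m = m and k = k and i = i, OF t(1) mt c kt] x1[of i] by linarith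
        qed
        also have "\<dots> = ?u * (\<Sum>i\<le>I. (2 powr - \<eta>) ^ i) + ?v * (\<Sum>i\<le>I. (2 powr (1 - 3 * \<eta>)) ^ i) +
            (\<Sum>i\<le>I. (2 powr \<eta>) ^ i)"
          by (simp add: sum.distrib sum_distrib_left)
        also have "\<dots> \<le> ?u * G + ?v * (G' * real t powr (1 - 3 * \<eta>)) + G * real t powr \<eta>"
        proof (intro add_mono mult_left_mono)
          show "(\<Sum>i\<le>I. (2 powr - \<eta>) ^ i) \<le> G"
            unfolding G_def using lt1 by (intro sum_geometric_le) auto
          show "(\<Sum>i\<le>I. (2 powr (1 - 3 * \<eta>)) ^ i) \<le> G' * real t powr (1 - 3 * \<eta>)"
            unfolding G'_def by (rule sum_geometric_levels_le[OF \<eta>3 I(2)])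
          show "(\<Sum>i\<le>I. (2 powr \<eta>) ^ i) \<le> G * real t powr \<eta>"
            unfolding G_def by (rule sum_geometric_levels_le[OF \<eta>(1) I(2)])
        qed (use c in auto)
        also have "?v * (G' * real t powr (1 - 3 * \<eta>)) = 32768 / c ^ 3 * G' * real t powr (1 - \<alpha>)"
        proof -
          have "real t powr (3 * \<eta> - \<alpha>) * real t powr (1 - 3 * \<eta>) = real t powr (1 - \<alpha>)"
            by (simp add: powr_add[symmetric])
          then show ?thesis by (simp add: mult.assoc mult.left_commute)
        qed
        also have "?u * G + 32768 / c ^ 3 * G' * real t powr (1 - \<alpha>) + G * real t powr \<eta> \<le>
           K * real t powr (1 - \<alpha>)"
        proof -
          have "real t powr \<eta> \<le> real t powr (1 - \<alpha>)" using t \<eta> \<alpha> by (intro powr_mono) auto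
          then have "(128 / c * G + G) * real t powr \<eta> \<le> (128 / c * G + G) * real t powr (1 - \<alpha>)"
            using c G by (intro mult_left_mono) auto
          then show ?thesis by (simp add: K_def algebra_simps)
        qed
        also have "K * real t powr (1 - \<alpha>) \<le> b t"
          using t0[of t] False t by (simp add: field_simps)
        finally show ?thesis .
      qed
      show False using breaker_defends[OF mono_m k2 budget total] mg by blast
    qed
  qed
qed

end

theorem theorem3:
  fixes \<alpha> :: real and m b :: "nat \<Rightarrow> nat"
  assumes "0 < \<alpha>" and "\<alpha> < 1"
    and "mono m" and "mono b"
    and "\<And>t. 1 \<le> t \<Longrightarrow> int (m t) = \<lfloor>real t powr \<alpha>\<rfloor> \<or> int (m t) = \<lceil>real t powr \<alpha>\<rceil>"
    and "filterlim (\<lambda>t. real (b t) / real t powr (1 - \<alpha>)) at_top sequentially"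
  shows "breaker_win m b"
proof -
  note m = assms(1,2,3,5)
  have guar: "\<exists>t. maker_guarantees m b n t" if "1 \<le> n" for n
    using ex_m_ge[OF m, of n] maker_guarantees_row that by blast
  \<comment> \<open>The value forced by the required equation. Its limit needs both bounds:
    Breaker's defence for \<open>m (winning_time m b n)\<close> from below and Maker's row from
    above.\<close>
  define \<epsilon> where "\<epsilon> n = 1 - real (m (winning_time m b n)) / n" for n
  have "\<epsilon> \<longlonglongrightarrow> 0"
  proof (rule tendstoI)
    fix e :: real assume e: "0 < e"
    have "\<forall>\<^sub>F n in sequentially. 3 / e \<le> real n"
      using filterlim_real_sequentially by (simp add: filterlim_at_top)
    moreover have "\<forall>\<^sub>F n in sequentially. 1 \<le> (n::nat)" by (rule eventually_ge_at_top)
    moreover have "\<forall>\<^sub>F n in sequentially. \<forall>t. maker_guarantees m b n t \<longrightarrow> (1 - e / 2) * real n \<le> m t"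
      using maker_needs_almost_n[OF m assms(6), of "e / 2"] e by simp
    ultimately show "\<forall>\<^sub>F n in sequentially. dist (\<epsilon> n) 0 < e"
    proof eventually_elim
      case (elim n)
      let ?M = "real (m (winning_time m b n))"
      have n: "0 < real n" using elim by simp
      have "maker_guarantees m b n (winning_time m b n)"
        unfolding winning_time_def using guar[OF elim(2)] by (rule LeastI_ex)
      then have lo: "(1 - e / 2) * real n \<le> ?M" using elim(3) by blast
      have "?M \<le> real (n + 2)" using winning_time_upper[OF m elim(2)] by (rule of_nat_mono)
      then have hi: "?M \<le> n + 2" by simp
      have "1 - e / 2 \<le> ?M / n" using lo n by (simp add: field_simps)
      moreover have "2 < e * n" using elim(1) e by (simp add: field_simps)
      then have "?M / n < 1 + e" using hi n by (simp add: field_simps)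
      ultimately show ?case using e by (simp add: \<epsilon>_def dist_real_def)
    qed
  qed
  then have "\<epsilon> \<in> o(\<lambda>_. 1)" by (intro smalloI_tendsto) auto
  moreover have "\<forall>\<^sub>F n in sequentially. real (m (winning_time m b n)) = (1 - \<epsilon> n) * real n"
    using eventually_ge_at_top[of 1] by eventually_elim (simp add: \<epsilon>_def)
  moreover have "\<forall>\<^sub>F n in sequentially. \<exists>t. maker_guarantees m b n t"
    using eventually_ge_at_top[of 1] by eventually_elim (rule guar)
  ultimately show ?thesis unfolding breaker_win_def by blast
qed

end
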